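(* Let $\Gamma\curvearrowright X$ be an EDS, where $\Gamma$ is a finitely generated and recursively presented group and the action admits a generating open cover. Then $\Gamma\curvearrowright X$ is a topological factor of an effective $\Gamma$-subshift. Moreover, if $X$ is zero-dimensional, then $\Gamma \curvearrowright X$ is topologically conjugate to an effective $\Gamma$-subshift, and the hypothesis that $\Gamma$ is recursively presented can be removed: for every finitely generated group $\Gamma$, every EDS $\Gamma\curvearrowright X$ with $X$ zero-dimensional which admits a generating open cover is topologically conjugate to an effective $\Gamma$-subshift.
   Context: All actions are by homeomorphisms on compact metrizable spaces; zero-dimensional means compact, metrizable and of topological dimension zero. r.e. means recursively enumerable. Generating covers. A cover of $X$ is a finite collection of sets whose union is $X$; it is open if its elements are open. The join of covers is $\mathcal P\vee\mathcal P'=\{P\cap P':P\in\mathcal P,P'\in\mathcal P'\}$, and the diameter of a cover is the maximum diameter of its elements (for a metric compatible with the topology). A cover $\mathcal P$ is generating for $\Gamma\curvearrowright X$ if for each $\varepsilon>0$ there is a finite $F\subset\Gamma$ such that $\bigvee_{g\in F}g^{-1}\mathcal P$ has diameter at most $\varepsilon$. A topological factor map is a continuous surjective $\Gamma$-equivariant map; it is a topological conjugacy if it is a homeomorphism. A finitely generated group is recursively presented if for some (equivalently, any) finite symmetric generating set $S$ the set of words in $S^*$ representing the identity is r.e. EDS. A computable metric space is $(X,d,\mathcal{S})$ where $(X,d)$ is a separable metric space, $\mathcal{S}=\{s_i: i\ge 0\}$ is dense, and there is an algorithm which on input $(i,j,n)$ outputs $r\in\mathbb{Q}$ with $|d(s_i,s_j)-r|\le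 2^{-n}$. Basic balls are open balls centered at points of $\mathcal{S}$ with positive rational radius; fix a computable enumeration $(B_n)_{n\in\mathbb{N}}$ of them and put $U_I=\bigcup_{n\in I}B_n$. A compact set $K\subset X$ is recursively compact if there is an algorithm which, given a finite $I\subset\mathbb{N}$, halts iff $K\subset U_I$. A map $f\colon Y\subset X\to X'$ between computable metric spaces is computable if there is an algorithm which, given $m$, enumerates $I_m$ with $f^{-1}(B'_m)=U_{I_m}\cap Y$, where $(B'_m)_m$ enumerates the basic balls of $X'$. An action of a finitely generated group on a recursively compact subset of a computable metric space is computable if for some (equivalently any) finite generating set each generator acts by a computable map. An action of a finitely generated group on a compact metrizable space is an effective dynamical system (EDS) if it is topologically conjugate to a computable action on some recursively compact subset of a computable metric space. Effective subshifts. For a finite alphabet $A$, $\Gamma$ acts on $A^\Gamma$ (prodiscrete topology) by $(gx)(h)=x(g^{-1}h)$; a $\Gamma$-subshift is a closed $\Gamma$-invariant subset. Let $S$ be a finite generating set of $\Gamma$, $F(S)$ the free group on $S$, $\phi\colon F(S)\to\Gamma$ the canonical epimorphism. The pullback of a subshift $X\subset A^\Gamma$ is $\widehat X=\{x\circ\phi:x\in X\}\subset A^{F(S)}$. $X$ is effective if for some (equivalently any) finite generating set $S$ the set $\widehat X$ is effectively closed in $A^{F(S)}$, i.e. the set of patterns $p\colon W\to A$, $W\subset F(S)$ finite, such that no $y\in\widehat X$ satisfies $y|_W=p$ is r.e. *)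

theory Defs
  imports
    "HOL-Analysis.Analysis"
    "HOL-Algebra.Group_Action"
    "HOL-Algebra.Generated_Groups"
    "HOL-Library.Nat_Bijection"
begin

section \<open>Partial recursive functions\<close>

text \<open>
  Algorithms are terms for partial recursive functions (primitive recursion plus minimisation).
  \<open>computes f xs y\<close> says that \<open>f\<close>, run on the argument tuple \<open>xs\<close>, halts with value \<open>y\<close>.
\<close>

datatype recf =
    Zero | Succ | Proj nat | Comp recf "recf list" | PrimRec recf recf | Mu recf

inductive computes :: "recf \<Rightarrow> nat list \<Rightarrow> nat \<Rightarrow> bool" where
  zero: "computes Zero xs 0"
| succ: "computes Succ (x # xs) (Suc x)"
| proj: "i < length xs \<Longrightarrow> computes (Proj i) xs (xs ! i)"
| comp: "length ys = length gs \<Longrightarrow> (\<forall>i<length gs. computes (gs ! i) xs (ys ! i)) \<Longrightarrow>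
         computes f ys z \<Longrightarrow> computes (Comp f gs) xs z"
| prim_0: "computes f xs z \<Longrightarrow> computes (PrimRec f g) (0 # xs) z"
| prim_Suc: "computes (PrimRec f g) (n # xs) y \<Longrightarrow> computes g (n # y # xs) z \<Longrightarrow>
         computes (PrimRec f g) (Suc n # xs) z"
| mu: "computes f (n # xs) 0 \<Longrightarrow> (\<forall>m<n. \<exists>y. computes f (m # xs) (Suc y)) \<Longrightarrow>
         computes (Mu f) xs n"

definition halts :: "recf \<Rightarrow> nat list \<Rightarrow> bool" where
  "halts f xs \<longleftrightarrow> (\<exists>y. computes f xs y)"

text \<open>
  The set enumerated by \<open>f\<close> on input \<open>xs\<close>: the extra argument is the stage, and at a stage where
  \<open>f\<close> diverges nothing is output (so the empty set can be enumerated).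
\<close>

definition enumerated :: "recf \<Rightarrow> nat list \<Rightarrow> nat set" where
  "enumerated f xs = {y. \<exists>k. computes f (xs @ [k]) y}"

definition re_set :: "nat set \<Rightarrow> bool" where
  "re_set A \<longleftrightarrow> (\<exists>f. A = enumerated f [])"

definition rat_of_code :: "nat \<Rightarrow> real" where
  "rat_of_code n = (case prod_decode n of (a, b) \<Rightarrow> of_int (int_decode a) / of_nat (Suc b))"

definition posrat_of_code :: "nat \<Rightarrow> real" where
  "posrat_of_code n = (case prod_decode n of (a, b) \<Rightarrow> of_nat (Suc a) / of_nat (Suc b))"


section \<open>Computable metric spaces\<close>

definition computable_metric_space ::
    "'m set \<Rightarrow> ('m \<Rightarrow> 'm \<Rightarrow> real) \<Rightarrow> (nat \<Rightarrow> 'm) \<Rightarrow> bool" where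
  "computable_metric_space M d s \<longleftrightarrow>
     Metric_space M d \<and> range s \<subseteq> M \<and>
     Metric_space.mtopology M d closure_of range s = M \<and>
     (\<exists>f. \<forall>i j n. \<exists>c. computes f [i, j, n] c \<and> \<bar>d (s i) (s j) - rat_of_code c\<bar> \<le> 1 / 2 ^ n)"

definition basic_ball ::
    "'m set \<Rightarrow> ('m \<Rightarrow> 'm \<Rightarrow> real) \<Rightarrow> (nat \<Rightarrow> 'm) \<Rightarrow> nat \<Rightarrow> 'm set" where
  "basic_ball M d s n =
     (case prod_decode n of (i, q) \<Rightarrow> Metric_space.mball M d (s i) (posrat_of_code q))"

definition ball_union ::
    "'m set \<Rightarrow> ('m \<Rightarrow> 'm \<Rightarrow> real) \<Rightarrow> (nat \<Rightarrow> 'm) \<Rightarrow> nat set \<Rightarrow> 'm set" where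
  "ball_union M d s I = (\<Union>n\<in>I. basic_ball M d s n)"

definition recursively_compact ::
    "'m set \<Rightarrow> ('m \<Rightarrow> 'm \<Rightarrow> real) \<Rightarrow> (nat \<Rightarrow> 'm) \<Rightarrow> 'm set \<Rightarrow> bool" where
  "recursively_compact M d s K \<longleftrightarrow>
     compactin (Metric_space.mtopology M d) K \<and>
     (\<exists>f. \<forall>is. halts f [list_encode is] \<longleftrightarrow> K \<subseteq> ball_union M d s (set is))"

definition computable_map ::
    "'m set \<Rightarrow> ('m \<Rightarrow> 'm \<Rightarrow> real) \<Rightarrow> (nat \<Rightarrow> 'm) \<Rightarrow> 'm set \<Rightarrow>
     'n set \<Rightarrow> ('n \<Rightarrow> 'n \<Rightarrow> real) \<Rightarrow> (nat \<Rightarrow> 'n) \<Rightarrow> ('m \<Rightarrow> 'n) \<Rightarrow> bool" where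
  "computable_map M d s Y M' d' s' f \<longleftrightarrow>
     f \<in> Y \<rightarrow> M' \<and>
     (\<exists>e. \<forall>m. {y \<in> Y. f y \<in> basic_ball M' d' s' m} = ball_union M d s (enumerated e [m]) \<inter> Y)"


section \<open>Finitely generated groups\<close>

text \<open>
  A finite generating set is given as a list without repetitions, so that its elements are
  numbered; words are then lists of indices into the list.
\<close>

definition generating_list :: "('g, 'b) monoid_scheme \<Rightarrow> 'g list \<Rightarrow> bool" where
  "generating_list G gs \<longleftrightarrow>
     distinct gs \<and> set gs \<subseteq> carrier G \<and> generate G (set gs) = carrier G"

definition finitely_generated :: "('g, 'b) monoid_scheme \<Rightarrow> bool" where
  "finitely_generated G \<longleftrightarrow> group G \<and> (\<exists>gs. generating_list G gs)"

definition monoid_word_value :: "('g, 'b) monoid_scheme \<Rightarrow> 'g list \<Rightarrow> nat list \<Rightarrow> 'g" where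
  "monoid_word_value G gs w = foldr (\<lambda>i h. gs ! i \<otimes>\<^bsub>G\<^esub> h) w \<one>\<^bsub>G\<^esub>"

definition recursively_presented :: "('g, 'b) monoid_scheme \<Rightarrow> bool" where
  "recursively_presented G \<longleftrightarrow> group G \<and>
     (\<exists>gs. generating_list G gs \<and> (\<forall>g\<in>set gs. inv\<^bsub>G\<^esub> g \<in> set gs) \<and>
        re_set {list_encode w | w. set w \<subseteq> {..<length gs} \<and> monoid_word_value G gs w = \<one>\<^bsub>G\<^esub>})"

text \<open>
  The free group on \<open>n\<close> generators is represented by its reduced words. A letter \<open>(i, True)\<close>
  is the \<open>i\<close>-th generator and \<open>(i, False)\<close> its inverse.
\<close>

type_synonym word = "(nat \<times> bool) list"

definition free_group_words :: "nat \<Rightarrow> word set" where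
  "free_group_words n =
     {w. fst ` set w \<subseteq> {..<n} \<and> successively (\<lambda>(i, b) (j, c). \<not> (i = j \<and> b \<noteq> c)) w}"

definition canonical_epi :: "('g, 'b) monoid_scheme \<Rightarrow> 'g list \<Rightarrow> word \<Rightarrow> 'g" where
  "canonical_epi G gs w =
     foldr (\<lambda>(i, b) h. (if b then gs ! i else inv\<^bsub>G\<^esub> (gs ! i)) \<otimes>\<^bsub>G\<^esub> h) w \<one>\<^bsub>G\<^esub>"

definition word_encode :: "word \<Rightarrow> nat" where
  "word_encode w = list_encode (map (\<lambda>(i, b). prod_encode (i, of_bool b)) w)"


section \<open>Topological dynamics\<close>

definition topological_action ::
    "('g, 'b) monoid_scheme \<Rightarrow> 'x topology \<Rightarrow> ('g \<Rightarrow> 'x \<Rightarrow> 'x) \<Rightarrow> bool" where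
  "topological_action G X a \<longleftrightarrow>
     compact_space X \<and> metrizable_space X \<and>
     group_action G (topspace X) a \<and> (\<forall>g\<in>carrier G. homeomorphic_map X X (a g))"

definition topological_factor_map ::
    "('g, 'b) monoid_scheme \<Rightarrow> 'x topology \<Rightarrow> ('g \<Rightarrow> 'x \<Rightarrow> 'x) \<Rightarrow>
     'y topology \<Rightarrow> ('g \<Rightarrow> 'y \<Rightarrow> 'y) \<Rightarrow> ('x \<Rightarrow> 'y) \<Rightarrow> bool" where
  "topological_factor_map G X a Y b \<pi> \<longleftrightarrow>
     continuous_map X Y \<pi> \<and> \<pi> ` topspace X = topspace Y \<and>
     (\<forall>g\<in>carrier G. \<forall>x\<in>topspace X. \<pi> (a g x) = b g (\<pi> x))"

definition topological_conjugacy ::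
    "('g, 'b) monoid_scheme \<Rightarrow> 'x topology \<Rightarrow> ('g \<Rightarrow> 'x \<Rightarrow> 'x) \<Rightarrow>
     'y topology \<Rightarrow> ('g \<Rightarrow> 'y \<Rightarrow> 'y) \<Rightarrow> ('x \<Rightarrow> 'y) \<Rightarrow> bool" where
  "topological_conjugacy G X a Y b \<pi> \<longleftrightarrow>
     topological_factor_map G X a Y b \<pi> \<and> homeomorphic_map X Y \<pi>"

definition is_open_cover :: "'x topology \<Rightarrow> 'x set set \<Rightarrow> bool" where
  "is_open_cover X P \<longleftrightarrow> finite P \<and> (\<forall>U\<in>P. openin X U) \<and> \<Union>P = topspace X"

text \<open>
  \<open>translated_join X a P F\<close> is the join over \<open>g \<in> F\<close> of the covers \<open>g\<inverse>P\<close>. An element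
  of it is given by a choice \<open>c g \<in> P\<close> for each \<open>g \<in> F\<close>; the join over the empty set is \<open>{X}\<close>.
\<close>

definition translated_join ::
    "'x topology \<Rightarrow> ('g \<Rightarrow> 'x \<Rightarrow> 'x) \<Rightarrow> 'x set set \<Rightarrow> 'g set \<Rightarrow> 'x set set" where
  "translated_join X a P F = {{x \<in> topspace X. \<forall>g\<in>F. a g x \<in> c g} | c. c \<in> F \<rightarrow> P}"

definition cover_diam_le :: "('x \<Rightarrow> 'x \<Rightarrow> real) \<Rightarrow> 'x set set \<Rightarrow> real \<Rightarrow> bool" where
  "cover_diam_le d P \<epsilon> \<longleftrightarrow> (\<forall>A\<in>P. \<forall>x\<in>A. \<forall>y\<in>A. d x y \<le> \<epsilon>)"

definition generating_cover ::
    "('g, 'b) monoid_scheme \<Rightarrow> 'x topology \<Rightarrow> ('g \<Rightarrow> 'x \<Rightarrow> 'x) \<Rightarrow> 'x set set \<Rightarrow> bool" where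
  "generating_cover G X a P \<longleftrightarrow>
     (\<exists>d. Metric_space (topspace X) d \<and> Metric_space.mtopology (topspace X) d = X \<and>
        (\<forall>\<epsilon>>0. \<exists>F. finite F \<and> F \<subseteq> carrier G \<and> cover_diam_le d (translated_join X a P F) \<epsilon>))"

text \<open>Lebesgue covering dimension at most \<open>n\<close>.\<close>

definition covering_dim_le :: "'x topology \<Rightarrow> nat \<Rightarrow> bool" where
  "covering_dim_le X n \<longleftrightarrow>
     (\<forall>P. is_open_cover X P \<longrightarrow>
        (\<exists>Q. is_open_cover X Q \<and> (\<forall>V\<in>Q. \<exists>U\<in>P. V \<subseteq> U) \<and>
             (\<forall>x\<in>topspace X. card {V \<in> Q. x \<in> V} \<le> n + 1)))"

text \<open>The empty space is included.\<close>

definition zero_dimensional :: "'x topology \<Rightarrow> bool" where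
  "zero_dimensional X \<longleftrightarrow> compact_space X \<and> metrizable_space X \<and> covering_dim_le X 0"


section \<open>Effective dynamical systems\<close>

definition computable_action ::
    "('g, 'b) monoid_scheme \<Rightarrow> 'm set \<Rightarrow> ('m \<Rightarrow> 'm \<Rightarrow> real) \<Rightarrow> (nat \<Rightarrow> 'm) \<Rightarrow>
     'm set \<Rightarrow> ('g \<Rightarrow> 'm \<Rightarrow> 'm) \<Rightarrow> bool" where
  "computable_action G M d s K b \<longleftrightarrow>
     computable_metric_space M d s \<and> recursively_compact M d s K \<and>
     topological_action G (subtopology (Metric_space.mtopology M d) K) b \<and>
     (\<exists>gs. generating_list G gs \<and> (\<forall>g\<in>set gs. computable_map M d s K M d s (b g)))"

text \<open>
  The type \<open>'m\<close> of the points of the computable metric space cannot be quantified inside a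
  definition, so it is a parameter; a statement about all effective dynamical systems has to
  leave \<open>'m\<close> arbitrary.
\<close>

definition effective_dynamical_system ::
    "'m itself \<Rightarrow> ('g, 'b) monoid_scheme \<Rightarrow> 'x topology \<Rightarrow> ('g \<Rightarrow> 'x \<Rightarrow> 'x) \<Rightarrow> bool" where
  "effective_dynamical_system T G X a \<longleftrightarrow>
     finitely_generated G \<and> topological_action G X a \<and>
     (\<exists>(M :: 'm set) d s K b \<pi>. computable_action G M d s K b \<and>
        topological_conjugacy G X a (subtopology (Metric_space.mtopology M d) K) b \<pi>)"


section \<open>Effective subshifts\<close>

text \<open>Alphabets are finite sets of natural numbers, so that symbols can be handled by algorithms.\<close>

definition full_shift :: "('g, 'b) monoid_scheme \<Rightarrow> nat set \<Rightarrow> ('g \<Rightarrow> nat) topology" where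
  "full_shift G A = product_topology (\<lambda>_. discrete_topology A) (carrier G)"

definition shift :: "('g, 'b) monoid_scheme \<Rightarrow> 'g \<Rightarrow> ('g \<Rightarrow> nat) \<Rightarrow> 'g \<Rightarrow> nat" where
  "shift G g x = (\<lambda>h\<in>carrier G. x (inv\<^bsub>G\<^esub> g \<otimes>\<^bsub>G\<^esub> h))"

definition subshift :: "('g, 'b) monoid_scheme \<Rightarrow> nat set \<Rightarrow> ('g \<Rightarrow> nat) set \<Rightarrow> bool" where
  "subshift G A Y \<longleftrightarrow>
     finite A \<and> closedin (full_shift G A) Y \<and> (\<forall>g\<in>carrier G. shift G g ` Y \<subseteq> Y)"

definition pullback ::
    "('g, 'b) monoid_scheme \<Rightarrow> 'g list \<Rightarrow> ('g \<Rightarrow> nat) set \<Rightarrow> (word \<Rightarrow> nat) set" where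
  "pullback G gs Y =
     (\<lambda>x. restrict (x \<circ> canonical_epi G gs) (free_group_words (length gs))) ` Y"

text \<open>Patterns are finite partial maps from the free group to the alphabet.\<close>

definition patterns :: "nat \<Rightarrow> nat set \<Rightarrow> (word \<rightharpoonup> nat) set" where
  "patterns n A = {p. finite (dom p) \<and> dom p \<subseteq> free_group_words n \<and> ran p \<subseteq> A}"

definition excluded_patterns :: "nat \<Rightarrow> nat set \<Rightarrow> (word \<Rightarrow> nat) set \<Rightarrow> (word \<rightharpoonup> nat) set" where
  "excluded_patterns n A Z =
     {p \<in> patterns n A. \<not> (\<exists>y\<in>Z. \<forall>w\<in>dom p. p w = Some (y w))}"

text \<open>A pattern is coded through the duplicate-free lists of its graph, in any order.\<close>

definition pattern_codes :: "(word \<rightharpoonup> nat) set \<Rightarrow> nat set" where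
  "pattern_codes P =
     {list_encode (map (\<lambda>(w, c). prod_encode (word_encode w, c)) l) | l.
        distinct (map fst l) \<and> map_of l \<in> P}"

definition effectively_closed :: "nat \<Rightarrow> nat set \<Rightarrow> (word \<Rightarrow> nat) set \<Rightarrow> bool" where
  "effectively_closed n A Z \<longleftrightarrow> re_set (pattern_codes (excluded_patterns n A Z))"

definition effective_subshift ::
    "('g, 'b) monoid_scheme \<Rightarrow> nat set \<Rightarrow> ('g \<Rightarrow> nat) set \<Rightarrow> bool" where
  "effective_subshift G A Y \<longleftrightarrow> subshift G A Y \<and>
     (\<exists>gs. generating_list G gs \<and> effectively_closed (length gs) A (pullback G gs Y))"

end

theory Submission
  imports Defs
begin

text \<open>
  Let \<open>K\<close> be the recursively compact model of the system. Choose finitely many closed sets \<open>C i\<close> that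
  cover \<open>K\<close>, refine the generating cover, and have as complements finite unions of basic balls. The
  configurations \<open>x\<close> for which some point \<open>z\<close> satisfies \<open>g\<inverse>z \<in> C (x g)\<close> for all \<open>g\<close> form a subshift;
  \<open>z\<close> is unique because the cover is generating, and \<open>x \<mapsto> z\<close> is the factor map. A pattern is excluded
  iff it prescribes different symbols at two words with the same value, which is semidecidable when
  the group is recursively presented, or if \<open>K\<close> is covered by the translates of the complements that
  the pattern names, which is semidecidable by recursive compactness. In dimension zero the sets \<open>C i\<close>
  can be taken disjoint: then the factor map is injective, and an inconsistent pattern is already
  excluded by the second criterion, so that the word problem is not needed.

  Every algorithm is obtained from the closure properties of semidecidable predicates. The graph of a
  given program is itself semidecidable, by induction on the program, so no universal machine is used.
\<close>


section \<open>Computability on coded types\<close>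

text \<open>Recursive compactness can confirm that open sets cover \<open>K\<close>, so excluding a
  pattern has to be an open condition on the points of \<open>K\<close>. This is why the coding uses
  closed sets with effectively open complements instead of the open cover itself; the Lebesgue
  number of the open cover pays for the shrinking. The action is computable on generators only,
  whereas the coding also moves points by inverses of generators. Their computability is not given
  and has to be extracted from recursive compactness. All finite data, namely the cover, its ball
  indices and the algorithms of the single letters, are hard-wired into one program and may
  therefore be chosen non-constructively. Uniformity is required only in the word and in the
  pattern.\<close>

lemma computes_unique: "computes f xs y \<Longrightarrow> computes f xs z \<Longrightarrow> y = z"
proof (induction arbitrary: z rule: computes.induct)
  case (comp ys gs xs f v)
  from comp.prems obtain ys' where ys': "length ys' = length gs"
    "\<forall>i<length gs. computes (gs ! i) xs (ys' ! i)" "computes f ys' z"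
    by (cases rule: computes.cases) auto
  have "ys = ys'"
    using ys'(1,2) comp.hyps(1) comp.IH(1) by (intro nth_equalityI) auto
  then show ?case using comp.IH(2) ys'(3) by simp
next
  case (prim_Suc f g n xs y v)
  from prim_Suc.prems show ?case
    by (cases rule: computes.cases) (use prim_Suc.IH in auto)
next
  case (mu f n xs)
  from mu.prems have z: "computes f (z # xs) 0" "\<forall>m<z. \<exists>y. computes f (m # xs) (Suc y)"
    by (cases rule: computes.cases; auto)+
  show ?case
  proof (cases n z rule: linorder_cases)
    case less
    with z(2) mu.IH(1) show ?thesis by fastforce
  next
    case greater
    with mu.IH(2) z(1) show ?thesis by fastforce
  qed
qed (erule computes.cases; auto)+

section \<open>Programs for arithmetic and pairing\<close>

lemma computes_Comp1: "computes g xs y \<Longrightarrow> computes f [y] z \<Longrightarrow> computes (Comp f [g]) xs z"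
  by (rule computes.comp[of "[y]"]) auto

lemma computes_Comp2:
  "computes g xs y \<Longrightarrow> computes g' xs y' \<Longrightarrow> computes f [y, y'] z \<Longrightarrow> computes (Comp f [g, g']) xs z"
  by (rule computes.comp[of "[y, y']"]) (auto simp: less_Suc_eq)

lemma computes_Proj: "i < length xs \<Longrightarrow> y = xs ! i \<Longrightarrow> computes (Proj i) xs y"
  by (simp add: computes.proj)

primrec const_rf :: "nat \<Rightarrow> recf" where
  "const_rf 0 = Zero"
| "const_rf (Suc n) = Comp Succ [const_rf n]"

lemma computes_const_rf: "computes (const_rf n) xs n"
  by (induction n) (auto intro: computes.zero computes.succ computes_Comp1)

definition "add_rf = PrimRec (Proj 0) (Comp Succ [Proj 1])"

lemma computes_add_rf: "computes add_rf [m, n] (m + n)"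
  unfolding add_rf_def
proof (induction m)
  case 0
  then show ?case by (auto intro!: computes.prim_0 computes_Proj)
next
  case (Suc m)
  have step: "computes (Comp Succ [Proj 1]) [m, m + n, n] (Suc (m + n))"
    by (rule computes_Comp1[OF computes_Proj computes.succ]) auto
  show ?case
    unfolding add_Suc by (rule computes.prim_Suc[OF Suc step])
qed

definition "pred_rf = PrimRec Zero (Proj 0)"

lemma computes_pred_rf: "computes pred_rf [n] (n - 1)"
  unfolding pred_rf_def
proof (induction n)
  case 0
  then show ?case by (auto intro!: computes.prim_0 computes.zero)
next
  case (Suc n)
  show ?case by (auto intro!: computes.prim_Suc[OF Suc] computes_Proj)
qed

text \<open>The subtrahend comes first because \<open>PrimRec\<close> recurses on its first
  argument.\<close>

definition "sub_rf = PrimRec (Proj 0) (Comp pred_rf [Proj 1])"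

lemma computes_sub_rf: "computes sub_rf [n, m] (m - n)"
  unfolding sub_rf_def
proof (induction n)
  case 0
  then show ?case by (auto intro!: computes.prim_0 computes_Proj)
next
  case (Suc n)
  have "computes pred_rf [m - n] (m - Suc n)"
    using computes_pred_rf[of "m - n"] by simp
  then show ?case
    by (intro computes.prim_Suc[OF Suc] computes_Comp1 computes_Proj) auto
qed

definition "triangle_rf = PrimRec Zero (Comp add_rf [Proj 1, Comp Succ [Proj 0]])"

lemma computes_triangle_rf: "computes triangle_rf [n] (triangle n)"
  unfolding triangle_rf_def
proof (induction n)
  case 0
  then show ?case by (auto intro!: computes.prim_0 computes.zero)
next
  case (Suc n)
  have step: "computes (Comp add_rf [Proj 1, Comp Succ [Proj 0]]) [n, triangle n] (triangle n + Suc n)"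
    by (rule computes_Comp2[OF _ _ computes_add_rf])
       (auto intro!: computes_Proj computes_Comp1[OF _ computes.succ])
  show ?case
    unfolding triangle_Suc by (rule computes.prim_Suc[OF Suc step])
qed

definition "pair_rf = Comp add_rf [Comp triangle_rf [add_rf], Proj 0]"

lemma computes_pair_rf: "computes pair_rf [m, n] (prod_encode (m, n))"
  unfolding pair_rf_def prod_encode_def prod.case
  by (rule computes_Comp2[OF _ _ computes_add_rf])
     (auto intro!: computes_Proj computes_Comp1[OF computes_add_rf computes_triangle_rf])

text \<open>On \<open>prod_encode (m, n)\<close> this returns the index \<open>m + n\<close> of the diagonal.\<close>

definition "diag_rf = Mu (Comp sub_rf [Comp triangle_rf [Comp Succ [Proj 0]], Comp Succ [Proj 1]])"

lemma triangle_mono: "m \<le> n \<Longrightarrow> triangle m \<le> triangle n"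
  by (induction n rule: dec_induct) auto

text \<open>The diagonal of a code \<open>z\<close> is the least \<open>s\<close> with
  \<open>z < triangle (Suc s)\<close>. Truncated subtraction turns this test into
  \<open>Suc z - triangle (Suc s) = 0\<close>, which minimisation can search for.\<close>

lemma computes_diag_rf: "computes diag_rf [prod_encode (m, n)] (m + n)"
proof -
  define z where "z = prod_encode (m, n)"
  have z: "z = triangle (m + n) + m" by (simp add: z_def prod_encode_def)
  let ?h = "Comp sub_rf [Comp triangle_rf [Comp Succ [Proj 0]], Comp Succ [Proj 1]]"
  have h: "computes ?h [s, z] (Suc z - triangle (Suc s))" for s
    by (rule computes_Comp2[OF _ _ computes_sub_rf])
       (auto simp del: triangle_Suc
         intro!: computes_Proj computes_Comp1[OF computes_Comp1[OF _ computes.succ] computes_triangle_rf]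
           computes_Comp1[OF _ computes.succ])
  have "computes (Mu ?h) [z] (m + n)"
  proof (rule computes.mu)
    show "computes ?h [m + n, z] 0"
      using h[of "m + n"] by (simp add: z)
    show "\<forall>k<m + n. \<exists>y. computes ?h [k, z] (Suc y)"
    proof (intro allI impI)
      fix k assume "k < m + n"
      then have "triangle (Suc k) \<le> z" using triangle_mono[of "Suc k" "m + n"] z by linarith
      then have "Suc z - triangle (Suc k) = Suc (z - triangle (Suc k))" by simp
      then show "\<exists>y. computes ?h [k, z] (Suc y)" using h[of k] by metis
    qed
  qed
  then show ?thesis by (simp add: diag_rf_def z_def)
qed

definition "fst_rf = Comp sub_rf [Comp triangle_rf [diag_rf], Proj 0]"
definition "snd_rf = Comp sub_rf [fst_rf, diag_rf]"

lemma computes_fst_rf: "computes fst_rf [prod_encode (m, n)] m"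
proof -
  have "computes (Comp sub_rf [Comp triangle_rf [diag_rf], Proj 0]) [prod_encode (m, n)]
          (prod_encode (m, n) - triangle (m + n))"
    by (rule computes_Comp2[OF _ _ computes_sub_rf])
       (auto intro!: computes_Proj computes_Comp1[OF computes_diag_rf computes_triangle_rf])
  then show ?thesis by (simp add: fst_rf_def prod_encode_def)
qed

lemma computes_snd_rf: "computes snd_rf [prod_encode (m, n)] n"
  using computes_Comp2[OF computes_fst_rf computes_diag_rf computes_sub_rf, of m n]
  by (simp add: snd_rf_def)

section \<open>Types numbered bijectively by the naturals\<close>

class coded =
  fixes enc :: "'a \<Rightarrow> nat"
  assumes bij_enc: "bij enc"

text \<open>Since \<open>enc\<close> is bijective, every natural is a code. Hence decoding is total
  and is the identity at the level of codes, and a search through the naturals is a search through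
  any coded type.\<close>

definition dcd :: "nat \<Rightarrow> 'a::coded" where
  "dcd = inv_into UNIV enc"

lemma dcd_enc [simp]: "dcd (enc x) = x"
  by (simp add: dcd_def bij_enc bij_is_inj)

lemma enc_dcd [simp]: "enc (dcd n) = n"
  by (simp add: dcd_def bij_enc bij_is_surj surj_f_inv_f)

lemma enc_eq_iff [simp]: "enc x = enc y \<longleftrightarrow> x = y"
  by (metis dcd_enc)

instantiation nat :: coded
begin
definition enc_nat :: "nat \<Rightarrow> nat" where [simp]: "enc_nat n = n"
instance by standard (auto simp: bij_def inj_def surj_def)
end

instantiation prod :: (coded, coded) coded
begin
definition enc_prod :: "'a \<times> 'b \<Rightarrow> nat" where "enc_prod p = prod_encode (enc (fst p), enc (snd p))"
instance
proof
  have "inj (enc :: 'a \<times> 'b \<Rightarrow> nat)"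
    by (auto simp: inj_def enc_prod_def)
  moreover have "surj (enc :: 'a \<times> 'b \<Rightarrow> nat)"
  proof (rule surjI)
    fix n
    show "enc (map_prod dcd dcd (prod_decode n) :: 'a \<times> 'b) = n"
      by (simp add: enc_prod_def)
  qed
  ultimately show "bij (enc :: 'a \<times> 'b \<Rightarrow> nat)" by (rule bijI)
qed
end

lemma enc_Pair [simp]: "enc (x, y) = prod_encode (enc x, enc y)"
  by (simp add: enc_prod_def)

instantiation list :: (coded) coded
begin
definition enc_list :: "'a list \<Rightarrow> nat" where "enc_list xs = list_encode (map enc xs)"
instance
proof
  have "inj (enc :: 'a list \<Rightarrow> nat)"
    by (auto simp: inj_def enc_list_def list_encode_eq intro!: list.inj_map_strong)
  moreover have "surj (enc :: 'a list \<Rightarrow> nat)"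
  proof (rule surjI)
    fix n
    show "enc (map dcd (list_decode n) :: 'a list) = n"
      by (simp add: enc_list_def comp_def)
  qed
  ultimately show "bij (enc :: 'a list \<Rightarrow> nat)" by (rule bijI)
qed
end

lemma enc_Nil [simp]: "enc [] = 0"
  by (simp add: enc_list_def)

lemma enc_Cons [simp]: "enc (x # xs) = Suc (prod_encode (enc x, enc xs))"
  by (simp add: enc_list_def)

lemma enc_nat_list: "enc (xs :: nat list) = list_encode xs"
  by (simp add: enc_list_def map_idI)

lemma length_le_enc: "length xs \<le> enc xs"
proof (induction xs)
  case (Cons x xs)
  then show ?case using le_prod_encode_2[of "enc xs" "enc x"] by simp
qed simp


subsection \<open>Total recursive functions\<close>

definition crec :: "('a::coded \<Rightarrow> 'b::coded) \<Rightarrow> bool" where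
  "crec F \<longleftrightarrow> (\<exists>f. \<forall>x. computes f [enc x] (enc (F x)))"

lemma crec_const: "crec (\<lambda>x. c)"
  unfolding crec_def using computes_const_rf by blast

lemma crec_id: "crec (\<lambda>x. x)"
  unfolding crec_def by (rule exI[of _ "Proj 0"]) (auto intro: computes_Proj)

lemma crec_apply1:
  assumes "\<And>u. computes h [enc u] (enc (H u))" "crec f"
  shows "crec (\<lambda>x. H (f x))"
  using assms unfolding crec_def by (meson computes_Comp1)

lemma crec_apply2:
  assumes "\<And>u v. computes h [enc u, enc v] (enc (H u v))" "crec f" "crec g"
  shows "crec (\<lambda>x. H (f x) (g x))"
  using assms unfolding crec_def by (meson computes_Comp2)

lemma crec_comp: "crec h \<Longrightarrow> crec f \<Longrightarrow> crec (\<lambda>x. h (f x))"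
  unfolding crec_def by (meson computes_Comp1)

lemma crec_enc: "crec f \<Longrightarrow> crec (\<lambda>x. enc (f x))"
  by (simp add: crec_def)

lemma crec_dcd: "crec f \<Longrightarrow> crec (\<lambda>x. dcd (f x))"
  by (simp add: crec_def)

lemma crec_Suc: "crec f \<Longrightarrow> crec (\<lambda>x. Suc (f x))"
  by (rule crec_apply1[of Succ]) (auto intro: computes.succ)

lemma crec_add: "crec f \<Longrightarrow> crec g \<Longrightarrow> crec (\<lambda>x. f x + g x :: nat)"
  by (rule crec_apply2[of add_rf]) (auto intro: computes_add_rf)

lemma crec_diff: "crec f \<Longrightarrow> crec g \<Longrightarrow> crec (\<lambda>x. f x - g x :: nat)"
  by (rule crec_apply2[of sub_rf "\<lambda>u v. v - u"]) (auto intro: computes_sub_rf)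

lemma crec_Pair: "crec f \<Longrightarrow> crec g \<Longrightarrow> crec (\<lambda>x. (f x, g x))"
  by (rule crec_apply2[of pair_rf]) (auto intro: computes_pair_rf)

lemma crec_fst: "crec f \<Longrightarrow> crec (\<lambda>x. fst (f x))"
  by (rule crec_apply1[of fst_rf]) (auto simp: enc_prod_def intro: computes_fst_rf)

lemma crec_snd: "crec f \<Longrightarrow> crec (\<lambda>x. snd (f x))"
  by (rule crec_apply1[of snd_rf]) (auto simp: enc_prod_def intro: computes_snd_rf)

text \<open>The environment \<open>x\<close> is carried along as a parameter, so the start value,
  the step and the number of steps may all depend on it.\<close>

lemma crec_rec_nat:
  assumes "crec f" "crec (\<lambda>p. g (fst p) (fst (snd p)) (snd (snd p)))" "crec n"
  shows "crec (\<lambda>x. rec_nat (f x) (g x) (n x))"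
proof -
  from assms(1) obtain F where F: "\<And>x. computes F [enc x] (enc (f x))"
    by (auto simp: crec_def)
  from assms(2) obtain H
    where "\<And>p. computes H [enc p] (enc (g (fst p) (fst (snd p)) (snd (snd p))))"
    unfolding crec_def by blast
  then have H: "computes H [prod_encode (enc x, prod_encode (k, enc y))] (enc (g x k y))" for x k y
    by (metis enc_Pair enc_nat_def fst_conv snd_conv)
  \<comment> \<open>\<open>PrimRec\<close> passes counter, previous value and parameter as three
    arguments; \<open>H\<close> expects one code of a triple with the parameter in front.\<close>
  define G where "G = Comp H [Comp pair_rf [Proj 2, Comp pair_rf [Proj 0, Proj 1]]]"
  have G': "computes G [k, enc y, enc x] (enc (g x k y))" for k x y
    unfolding G_def
    by (intro computes_Comp1[OF _ H] computes_Comp2[OF _ _ computes_pair_rf] computes_Proj) auto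
  have R: "computes (PrimRec F G) [k, enc x] (enc (rec_nat (f x) (g x) k))" for k x
  proof (induction k)
    case 0
    show ?case by (simp add: F computes.prim_0)
  next
    case (Suc k)
    show ?case using computes.prim_Suc[OF Suc G'] by simp
  qed
  have "crec (\<lambda>x. rec_nat (f (snd (n x, x))) (g (snd (n x, x))) (fst (n x, x)))"
    unfolding snd_conv fst_conv
    by (rule crec_apply2[of "PrimRec F G" "\<lambda>k x. rec_nat (f x) (g x) k"])
       (auto simp: R assms(3) crec_id)
  then show ?thesis by simp
qed

lemma crec_mult:
  assumes "crec f" "crec g"
  shows "crec (\<lambda>x. f x * g x :: nat)"
proof -
  have "crec (\<lambda>x. rec_nat 0 (\<lambda>_ y. g x + y) (f x))"
    by (intro crec_rec_nat crec_const crec_add crec_fst crec_snd crec_id assms(1)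
        crec_comp[OF assms(2)])
  moreover have "rec_nat 0 (\<lambda>_ y. m + y) n = n * m" for m n :: nat
    by (induction n) auto
  ultimately show ?thesis by simp
qed

lemma crec_if_zero:
  fixes f g :: "'e::coded \<Rightarrow> 'b::coded"
  assumes "crec c" "crec f" "crec g"
  shows "crec (\<lambda>x. if c x = (0::nat) then f x else g x)"
proof -
  have "crec (\<lambda>x. rec_nat (f x) (\<lambda>_ _. g x) (c x))"
    by (intro crec_rec_nat crec_fst crec_id assms(1,2) crec_comp[OF assms(3)])
  moreover have "rec_nat u (\<lambda>_ _. v) n = (if n = 0 then u else v)" for u v :: 'b and n :: nat
    by (cases n) auto
  ultimately show ?thesis by simp
qed

text \<open>Truth is coded by 0, the value that \<open>crec_if_zero\<close> and \<open>Mu\<close>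
  test for.\<close>

definition decidable :: "('a::coded \<Rightarrow> bool) \<Rightarrow> bool" where
  "decidable P \<longleftrightarrow> crec (\<lambda>x. if P x then 0 else 1 :: nat)"

lemma crec_if:
  assumes "decidable P" "crec f" "crec g"
  shows "crec (\<lambda>x. if P x then f x else g x)"
proof -
  have "(\<lambda>x. if P x then f x else g x) = (\<lambda>x. if (if P x then 0 else 1) = (0::nat) then f x else g x)"
    by auto
  then show ?thesis
    using crec_if_zero[OF assms[unfolded decidable_def]] by simp
qed

lemma decidable_zero: "crec c \<Longrightarrow> decidable (\<lambda>x. c x = (0::nat))"
  unfolding decidable_def by (intro crec_if_zero crec_const)

lemma decidable_eq:
  fixes f g :: "'a::coded \<Rightarrow> 'b::coded"
  assumes "crec f" "crec g"
  shows "decidable (\<lambda>x. f x = g x)"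
proof -
  have "decidable (\<lambda>x. (enc (f x) - enc (g x)) + (enc (g x) - enc (f x)) = 0)"
    by (intro decidable_zero crec_add crec_diff crec_enc assms)
  moreover have "(enc u - enc v) + (enc v - enc u) = 0 \<longleftrightarrow> u = v" for u v :: 'b
    by (metis add_is_0 diff_is_0_eq enc_eq_iff le_antisym order_refl)
  ultimately show ?thesis by simp
qed

lemma decidable_le: "crec f \<Longrightarrow> crec g \<Longrightarrow> decidable (\<lambda>x. f x \<le> (g x :: nat))"
  using decidable_zero[OF crec_diff] by simp

lemma decidable_less: "crec f \<Longrightarrow> crec g \<Longrightarrow> decidable (\<lambda>x. f x < (g x :: nat))"
  using decidable_le[OF crec_Suc] by (simp add: Suc_le_eq)

lemma decidable_not:
  assumes "decidable P"
  shows "decidable (\<lambda>x. \<not> P x)"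
proof -
  have "crec (\<lambda>x. if P x then 1 else 0 :: nat)"
    by (intro crec_if assms crec_const)
  moreover have "(\<lambda>x. if P x then 1 else 0 :: nat) = (\<lambda>x. if \<not> P x then 0 else 1)" by auto
  ultimately show ?thesis by (simp add: decidable_def)
qed

lemma decidable_conj:
  assumes "decidable P" "decidable Q"
  shows "decidable (\<lambda>x. P x \<and> Q x)"
proof -
  have "crec (\<lambda>x. if P x then (if Q x then 0 else 1) else 1 :: nat)"
    by (intro crec_if assms crec_const)
  moreover have "(\<lambda>x. if P x then (if Q x then 0 else 1) else 1 :: nat) =
      (\<lambda>x. if P x \<and> Q x then 0 else 1)" by auto
  ultimately show ?thesis by (simp add: decidable_def)
qed

lemma decidable_disj:
  assumes "decidable P" "decidable Q"
  shows "decidable (\<lambda>x. P x \<or> Q x)"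
  using decidable_not[OF decidable_conj[OF decidable_not[OF assms(1)] decidable_not[OF assms(2)]]]
  by simp

lemma decidable_comp: "decidable P \<Longrightarrow> crec f \<Longrightarrow> decidable (\<lambda>x. P (f x))"
  unfolding decidable_def by (rule crec_comp)

text \<open>Since \<open>enc\<close> is bijective, \<open>dcd (enc ys - 1)\<close> is the pair of head and tail when \<open>ys\<close> is nonempty.\<close>

lemma dcd_uncons [simp]: "dcd (prod_encode (enc y, enc ys)) = (y, ys)"
  by (metis enc_Pair dcd_enc)

text \<open>The fold is a primitive recursion on the pair of accumulator and unread rest. The code
  of the list serves as the number of steps: it bounds the length by \<open>length_le_enc\<close>,
  and the steps after the end of the list change nothing.\<close>

lemma crec_foldl:
  fixes g :: "'e::coded \<Rightarrow> 's::coded \<Rightarrow> 'a::coded \<Rightarrow> 's"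
  assumes "crec i" "crec (\<lambda>p. g (fst p) (fst (snd p)) (snd (snd p)))" "crec xs"
  shows "crec (\<lambda>x. foldl (g x) (i x) (xs x))"
proof -
  define step where "step = (\<lambda>(x::'e) (k::nat) s. if enc (snd s) = 0 then s else
      (g x (fst s) (fst (dcd (enc (snd s) - 1) :: 'a \<times> 'a list)), snd (dcd (enc (snd s) - 1) :: 'a \<times> 'a list)))"
  have g: "crec (\<lambda>x. g (u x) (v x) (w x))" if "crec u" "crec v" "crec w" for u :: "'u::coded \<Rightarrow> 'e" and v w
    using crec_comp[OF assms(2) crec_Pair[OF that(1) crec_Pair[OF that(2,3)]]] by simp
  have "crec (\<lambda>p. step (fst p) (fst (snd p)) (snd (snd p)))"
    unfolding step_def
    by (intro crec_if decidable_zero crec_enc crec_Pair crec_fst crec_snd crec_dcd crec_diff crec_id crec_const g)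
  then have "crec (\<lambda>x. fst (rec_nat (i x, xs x) (step x) (enc (xs x))))"
    by (intro crec_fst crec_rec_nat crec_Pair crec_enc assms)
  moreover have *: "rec_nat (c, ys) (step x) n = (foldl (g x) c (take n ys), drop n ys)" for x c ys n
  proof (induction n)
    case (Suc n)
    show ?case
    proof (cases "n < length ys")
      case True
      then have "drop n ys = ys ! n # drop (Suc n) ys" by (simp add: Cons_nth_drop_Suc)
      then show ?thesis using Suc True by (simp add: step_def take_Suc_conv_app_nth)
    next
      case False
      then show ?thesis using Suc by (simp add: step_def)
    qed
  qed simp
  have "fst (rec_nat (i x, xs x) (step x) (enc (xs x))) = foldl (g x) (i x) (xs x)" for x
    unfolding * by (simp add: length_le_enc)
  ultimately show ?thesis by simp
qed

lemma crec_Cons: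
  fixes f :: "'e::coded \<Rightarrow> 'b::coded"
  assumes "crec f" "crec g"
  shows "crec (\<lambda>x. f x # g x)"
proof -
  have "crec (\<lambda>x. dcd (Suc (enc (f x, g x))) :: 'b list)"
    by (intro crec_dcd crec_Suc crec_enc crec_Pair assms)
  moreover have "dcd (Suc (enc (u, v))) = u # v" for u and v :: "'b list"
    by (metis enc_Cons enc_Pair dcd_enc)
  ultimately show ?thesis by simp
qed

lemma crec_hd:
  fixes f :: "'e::coded \<Rightarrow> 'b::coded list"
  assumes "crec f"
  shows "crec (\<lambda>x. hd (f x))"
proof -
  \<comment> \<open>\<open>hd []\<close> is unspecified, but it is one fixed value and so is
    returned by a constant program.\<close>
  have "crec (\<lambda>x. if enc (f x) = 0 then hd [] else fst (dcd (enc (f x) - 1) :: 'b \<times> 'b list))"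
    by (intro crec_if_zero crec_enc crec_const crec_fst crec_dcd crec_diff assms)
  moreover have "(if enc ys = 0 then hd [] else fst (dcd (enc ys - 1) :: 'b \<times> 'b list)) = hd ys" for ys :: "'b list"
    by (cases ys) auto
  ultimately show ?thesis by simp
qed

lemma crec_tl:
  fixes f :: "'e::coded \<Rightarrow> 'b::coded list"
  assumes "crec f"
  shows "crec (\<lambda>x. tl (f x))"
proof -
  have "crec (\<lambda>x. if enc (f x) = 0 then [] else snd (dcd (enc (f x) - 1) :: 'b \<times> 'b list))"
    by (intro crec_if_zero crec_enc crec_const crec_snd crec_dcd crec_diff assms)
  moreover have "(if enc ys = 0 then [] else snd (dcd (enc ys - 1) :: 'b \<times> 'b list)) = tl ys" for ys :: "'b list"
    by (cases ys) auto
  ultimately show ?thesis by simp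
qed

lemma crec_drop:
  fixes f :: "'e::coded \<Rightarrow> 'b::coded list"
  assumes "crec n" "crec f"
  shows "crec (\<lambda>x. drop (n x) (f x))"
proof -
  have "crec (\<lambda>x. rec_nat (f x) (\<lambda>_ ys. tl ys) (n x))"
    by (intro crec_rec_nat crec_tl crec_snd crec_id assms)
  moreover have "rec_nat ys (\<lambda>_ ys. tl ys) n = drop n ys" for ys :: "'b list" and n
    by (induction n) (auto simp: drop_Suc tl_drop)
  ultimately show ?thesis by simp
qed

text \<open>Indexing is written \<open>hd (drop n ys)\<close>, because \<open>ys ! n\<close> is unspecified for each \<open>n \<ge> length ys\<close>
  and hence not known to be recursive.\<close>

abbreviation entry :: "'a list \<Rightarrow> nat \<Rightarrow> 'a" where
  "entry ys n \<equiv> hd (drop n ys)"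

lemma crec_length:
  fixes f :: "'e::coded \<Rightarrow> 'b::coded list"
  assumes "crec f"
  shows "crec (\<lambda>x. length (f x))"
proof -
  have "crec (\<lambda>x. foldl (\<lambda>n _. Suc n) 0 (f x))"
    by (intro crec_foldl crec_const crec_Suc crec_snd crec_fst crec_id assms)
  moreover have "foldl (\<lambda>n _. Suc n) k ys = k + length ys" for ys :: "'b list" and k
    by (induction ys arbitrary: k) auto
  ultimately show ?thesis by simp
qed

lemma crec_rev:
  fixes f :: "'e::coded \<Rightarrow> 'b::coded list"
  assumes "crec f"
  shows "crec (\<lambda>x. rev (f x))"
proof -
  have "crec (\<lambda>x. foldl (\<lambda>zs y. y # zs) [] (f x))"
    by (intro crec_foldl crec_const crec_Cons crec_snd crec_fst crec_id assms)
  moreover have "foldl (\<lambda>zs y. y # zs) zs ys = rev ys @ zs" for ys zs :: "'b list"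
    by (induction ys arbitrary: zs) auto
  ultimately show ?thesis by simp
qed

lemma crec_append:
  fixes f g :: "'e::coded \<Rightarrow> 'b::coded list"
  assumes "crec f" "crec g"
  shows "crec (\<lambda>x. f x @ g x)"
proof -
  have "crec (\<lambda>x. foldl (\<lambda>zs y. y # zs) (g x) (rev (f x)))"
    by (intro crec_foldl crec_rev crec_Cons crec_snd crec_fst crec_id assms)
  moreover have "foldl (\<lambda>zs y. y # zs) zs ys = rev ys @ zs" for ys zs :: "'b list"
    by (induction ys arbitrary: zs) auto
  ultimately show ?thesis by simp
qed

lemma crec_map:
  assumes "crec h" "crec f"
  shows "crec (\<lambda>x. map h (f x))"
proof -
  have "crec (\<lambda>x. rev (foldl (\<lambda>zs y. h y # zs) [] (f x)))"
    by (intro crec_rev crec_foldl crec_const crec_Cons crec_comp[OF assms(1)] crec_snd crec_fst crec_id assms(2))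
  moreover have "foldl (\<lambda>zs y. h y # zs) zs ys = rev (map h ys) @ zs" for ys zs
    by (induction ys arbitrary: zs) auto
  ultimately show ?thesis by simp
qed

lemma crec_upt:
  assumes "crec n"
  shows "crec (\<lambda>x. [0..<n x])"
proof -
  have "crec (\<lambda>x. rec_nat [] (\<lambda>k ks. ks @ [k]) (n x))"
    by (intro crec_rec_nat crec_const crec_append crec_Cons crec_snd crec_fst crec_id assms)
  moreover have "rec_nat [] (\<lambda>k ks. ks @ [k]) n = [0..<n]" for n
    by (induction n) auto
  ultimately show ?thesis by simp
qed

lemma decidable_ball:
  assumes "decidable (\<lambda>p. P (fst p) (snd p))" "crec f"
  shows "decidable (\<lambda>x. \<forall>y\<in>set (f x). P x y)"
proof -
  have P: "decidable (\<lambda>x. P (u x) (v x))" if "crec u" "crec v" for u :: "'c::coded \<Rightarrow> 'a" and v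
    using decidable_comp[OF assms(1) crec_Pair[OF that]] by simp
  have "crec (\<lambda>x. foldl (\<lambda>c y. if P x y then c else 1) (0::nat) (f x))"
    by (intro crec_foldl crec_const crec_if P crec_snd crec_fst crec_id assms(2))
  moreover have "foldl (\<lambda>c y. if P x y then c else 1) c ys = (if \<forall>y\<in>set ys. P x y then c else (1::nat))" for x c ys
    by (induction ys arbitrary: c) auto
  ultimately show ?thesis by (simp add: decidable_def)
qed

lemma decidable_bex:
  assumes "decidable (\<lambda>p. P (fst p) (snd p))" "crec f"
  shows "decidable (\<lambda>x. \<exists>y\<in>set (f x). P x y)"
  using decidable_not[OF decidable_ball[OF decidable_not[OF assms(1)] assms(2)]] by simp

lemmas crec_intros = crec_const crec_id crec_fst crec_snd crec_Pair crec_Suc crec_add crec_diff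
  crec_mult crec_enc crec_dcd crec_Cons crec_hd crec_tl crec_drop crec_length crec_rev crec_append
  crec_upt

lemmas decidable_intros = decidable_conj decidable_disj decidable_not decidable_eq decidable_le decidable_less
  decidable_ball decidable_bex


subsection \<open>Semidecidable predicates\<close>

text \<open>The projective form, with a numerical witness, reduces the closure properties to the
  coding of witnesses; no programs have to be dovetailed.\<close>

definition semidec :: "('a::coded \<Rightarrow> bool) \<Rightarrow> bool" where
  "semidec P \<longleftrightarrow> (\<exists>D. decidable (\<lambda>p. D (fst p) (snd p)) \<and> (\<forall>x. P x \<longleftrightarrow> (\<exists>t::nat. D x t)))"

lemma semidecE:
  assumes "semidec P"
  obtains D where
    "\<And>(u :: 'c::coded \<Rightarrow> _) v. crec u \<Longrightarrow> crec v \<Longrightarrow> decidable (\<lambda>x. D (u x) (v x))"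
    "\<And>x. P x \<longleftrightarrow> (\<exists>t::nat. D x t)"
proof -
  from assms obtain D where D: "decidable (\<lambda>p. D (fst p) (snd p))" "\<And>x. P x \<longleftrightarrow> (\<exists>t::nat. D x t)"
    unfolding semidec_def by auto
  have "decidable (\<lambda>x. D (u x) (v x))" if "crec u" "crec v" for u :: "'c \<Rightarrow> _" and v
    using decidable_comp[OF D(1) crec_Pair[OF that]] by simp
  then show ?thesis using D(2) that by blast
qed

lemma semidec_decidable:
  assumes "decidable P"
  shows "semidec P"
  unfolding semidec_def
  by (rule exI[of _ "\<lambda>x _. P x"]) (simp add: decidable_comp[OF assms crec_fst[OF crec_id]])

lemma semidec_comp:
  assumes "semidec P" "crec f"
  shows "semidec (\<lambda>x. P (f x))"
proof -
  obtain D where D: "\<And>(u :: _ \<Rightarrow> _) v. crec u \<Longrightarrow> crec v \<Longrightarrow> decidable (\<lambda>x :: 'b \<times> nat. D (u x) (v x))"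
    "\<And>x. P x \<longleftrightarrow> (\<exists>t::nat. D x t)" using semidecE[OF assms(1)] by blast
  show ?thesis unfolding semidec_def
    by (rule exI[of _ "\<lambda>x t. D (f x) t"]) (intro conjI allI D D(1) crec_intros crec_comp[OF assms(2)])
qed

lemma ex_dcd_iff:
  fixes R :: "'b::coded \<Rightarrow> 'c::coded \<Rightarrow> bool"
  shows "(\<exists>t. R (fst (dcd t :: 'b \<times> 'c)) (snd (dcd t :: 'b \<times> 'c))) \<longleftrightarrow> (\<exists>u v. R u v)"
proof
  assume "\<exists>u v. R u v"
  then obtain u v where "R u v" by blast
  then have "R (fst (dcd (enc (u, v)) :: 'b \<times> 'c)) (snd (dcd (enc (u, v)) :: 'b \<times> 'c))"
    unfolding dcd_enc by simp
  then show "\<exists>t. R (fst (dcd t :: 'b \<times> 'c)) (snd (dcd t :: 'b \<times> 'c))" ..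
qed blast

lemma semidec_conj:
  assumes "semidec P" "semidec Q"
  shows "semidec (\<lambda>x. P x \<and> Q x)"
proof -
  obtain D where D: "\<And>(u :: _ \<Rightarrow> _) v. crec u \<Longrightarrow> crec v \<Longrightarrow> decidable (\<lambda>x :: 'a \<times> nat. D (u x) (v x))"
    "\<And>x. P x \<longleftrightarrow> (\<exists>t::nat. D x t)" using semidecE[OF assms(1)] by blast
  obtain E where E: "\<And>(u :: _ \<Rightarrow> _) v. crec u \<Longrightarrow> crec v \<Longrightarrow> decidable (\<lambda>x :: 'a \<times> nat. E (u x) (v x))"
    "\<And>x. Q x \<longleftrightarrow> (\<exists>t::nat. E x t)" using semidecE[OF assms(2)] by blast
  define F where "F = (\<lambda>x (t::nat). D x (fst (dcd t :: nat \<times> nat)) \<and> E x (snd (dcd t :: nat \<times> nat)))"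
  have "P x \<and> Q x \<longleftrightarrow> (\<exists>t. F x t)" for x
    unfolding F_def D(2) E(2) ex_dcd_iff[of "\<lambda>u v. D x u \<and> E x v"] by blast
  moreover have "decidable (\<lambda>p. F (fst p) (snd p))"
    unfolding F_def by (intro decidable_conj D(1) E(1) crec_intros)
  ultimately show ?thesis unfolding semidec_def by blast
qed

lemma semidec_disj:
  assumes "semidec P" "semidec Q"
  shows "semidec (\<lambda>x. P x \<or> Q x)"
proof -
  obtain D where D: "\<And>(u :: _ \<Rightarrow> _) v. crec u \<Longrightarrow> crec v \<Longrightarrow> decidable (\<lambda>x :: 'a \<times> nat. D (u x) (v x))"
    "\<And>x. P x \<longleftrightarrow> (\<exists>t::nat. D x t)" using semidecE[OF assms(1)] by blast
  obtain E where E: "\<And>(u :: _ \<Rightarrow> _) v. crec u \<Longrightarrow> crec v \<Longrightarrow> decidable (\<lambda>x :: 'a \<times> nat. E (u x) (v x))"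
    "\<And>x. Q x \<longleftrightarrow> (\<exists>t::nat. E x t)" using semidecE[OF assms(2)] by blast
  have "decidable (\<lambda>p. D (fst p) (snd p) \<or> E (fst p) (snd p))"
    by (intro decidable_disj D(1) E(1) crec_intros)
  then show ?thesis unfolding semidec_def
    by (intro exI[of _ "\<lambda>x t. D x t \<or> E x t"]) (auto simp: D(2) E(2))
qed

lemma semidec_ex:
  assumes "semidec (\<lambda>p. P (fst p) (snd p))"
  shows "semidec (\<lambda>x. \<exists>y::'b::coded. P x y)"
proof -
  obtain D where D: "\<And>(u :: _ \<Rightarrow> _) v. crec u \<Longrightarrow> crec v \<Longrightarrow> decidable (\<lambda>x :: 'a \<times> nat. D (u x) (v x))"
    "\<And>p. P (fst p) (snd p) \<longleftrightarrow> (\<exists>t::nat. D p t)" using semidecE[OF assms] by blast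
  define F where "F = (\<lambda>x (t::nat). D (x, fst (dcd t :: 'b \<times> nat)) (snd (dcd t :: 'b \<times> nat)))"
  have P: "P x y \<longleftrightarrow> (\<exists>t::nat. D (x, y) t)" for x y using D(2)[of "(x, y)"] by simp
  have "(\<exists>y. P x y) \<longleftrightarrow> (\<exists>t. F x t)" for x
    unfolding F_def P ex_dcd_iff[of "\<lambda>y t. D (x, y) t"] by (rule refl)
  moreover have "decidable (\<lambda>p. F (fst p) (snd p))"
    unfolding F_def by (intro D(1) crec_intros)
  ultimately show ?thesis unfolding semidec_def by blast
qed

text \<open>Finitely many witnesses lie below one bound \<open>T\<close>, for instance the successor
  of their sum, and searching below \<open>T\<close> is decidable.\<close>

lemma semidec_ball:
  assumes "semidec (\<lambda>p. P (fst p) (snd p))" "crec f"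
  shows "semidec (\<lambda>x. \<forall>y\<in>set (f x). P x y)"
proof -
  obtain D where D: "\<And>(u :: _ \<Rightarrow> _) v. crec u \<Longrightarrow> crec v \<Longrightarrow> decidable (\<lambda>x :: (('a \<times> nat) \<times> 'b) \<times> nat. D (u x) (v x))"
    "\<And>p. P (fst p) (snd p) \<longleftrightarrow> (\<exists>t::nat. D p t)" using semidecE[OF assms(1)] by blast
  define F where "F = (\<lambda>x (T::nat). \<forall>y\<in>set (f x). \<exists>t\<in>set [0..<T]. D (x, y) t)"
  have P: "P x y \<longleftrightarrow> (\<exists>t::nat. D (x, y) t)" for x y using D(2)[of "(x, y)"] by simp
  have "(\<forall>y\<in>set (f x). P x y) \<longleftrightarrow> (\<exists>T. F x T)" for x
  proof
    assume "\<forall>y\<in>set (f x). P x y"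
    then obtain t where t: "\<And>y. y \<in> set (f x) \<Longrightarrow> D (x, y) (t y)" unfolding P by metis
    have "F x (Suc (sum_list (map t (f x))))"
      unfolding F_def
    proof
      fix y assume y: "y \<in> set (f x)"
      then have "t y \<le> sum_list (map t (f x))" by (simp add: member_le_sum_list)
      then show "\<exists>t\<in>set [0..<Suc (sum_list (map t (f x)))]. D (x, y) t"
        using t[OF y] by (intro bexI[of _ "t y"]) auto
    qed
    then show "\<exists>T. F x T" ..
  qed (auto simp: F_def P)
  moreover have "decidable (\<lambda>p. F (fst p) (snd p))"
    unfolding F_def by (intro decidable_ball decidable_bex D(1) crec_intros crec_comp[OF assms(2)])
  ultimately show ?thesis unfolding semidec_def by blast
qed

lemma decidable_mem:
  assumes "crec f" "crec g"
  shows "decidable (\<lambda>x. f x \<in> set (g x))"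
proof -
  have "decidable (\<lambda>x. \<exists>y\<in>set (g x). f x = y)"
    by (intro decidable_intros crec_intros crec_comp[OF assms(1)] assms(2))
  then show ?thesis by simp
qed

lemma semidec_bex:
  assumes "semidec (\<lambda>p. P (fst p) (snd p))" "crec f"
  shows "semidec (\<lambda>x. \<exists>y\<in>set (f x). P x y)"
  unfolding Bex_def
  by (intro semidec_ex semidec_conj assms(1) semidec_decidable decidable_mem crec_intros
      crec_comp[OF assms(2)])

lemma semidec_all_less:
  fixes P :: "'a::coded \<Rightarrow> nat \<Rightarrow> bool"
  assumes "semidec (\<lambda>p. P (fst p) (snd p))" "crec f"
  shows "semidec (\<lambda>x. \<forall>i<f x. P x i)"
proof -
  have "semidec (\<lambda>x. \<forall>i\<in>set [0..<f x]. P x i)"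
    by (intro semidec_ball assms crec_intros)
  then show ?thesis by (simp add: Ball_def)
qed

text \<open>The predicates \<open>P i\<close> may have unrelated algorithms; finiteness of
  \<open>I\<close> replaces uniformity in \<open>i\<close>. This is how the letters of the group are
  handled in \<open>ex_step\<close>.\<close>

lemma semidec_finite_Bex:
  assumes "finite I" "\<And>i. i \<in> I \<Longrightarrow> semidec (P i)"
  shows "semidec (\<lambda>x. \<exists>i\<in>I. P i x)"
  using assms
proof (induction I)
  case empty
  have "semidec (\<lambda>_. 0 = (1::nat))"
    by (intro semidec_decidable decidable_intros crec_intros)
  then show ?case by simp
next
  case (insert i I)
  then show ?case by (auto intro: semidec_disj)
qed

lemmas semidec_intros = semidec_conj semidec_disj semidec_ex semidec_ball semidec_bex semidec_all_less

text \<open>A run of a primitive recursion is witnessed by the finite list of its intermediate values.\<close>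

lemma semidec_computes: "semidec (\<lambda>p. computes f (fst p) (snd p))"
proof (induction f)
  case Zero
  have *: "computes Zero xs y \<longleftrightarrow> y = 0" for xs y
    by (auto intro: computes.zero elim: computes.cases)
  show ?case unfolding * by (intro semidec_decidable decidable_intros crec_intros)
next
  case Succ
  have *: "computes Succ xs y \<longleftrightarrow> 0 < length xs \<and> y = Suc (hd xs)" for xs y
    by (cases xs) (auto intro: computes.succ elim: computes.cases)
  show ?case unfolding * by (intro semidec_decidable decidable_intros crec_intros)
next
  case (Proj i)
  have *: "computes (Proj i) xs y \<longleftrightarrow> i < length xs \<and> y = entry xs i" for xs y
    by (auto simp: hd_drop_conv_nth intro: computes_Proj elim: computes.cases)
  show ?case unfolding * by (intro semidec_decidable decidable_intros crec_intros)
next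
  case (Comp f gs)
  have gs: "semidec (\<lambda>p. list_all2 (\<lambda>g. computes g (fst p)) gs (snd p))"
    using Comp.IH(2)
  proof (induction gs)
    case Nil
    show ?case unfolding list_all2_Nil by (intro semidec_decidable decidable_intros crec_intros)
  next
    case (Cons g gs)
    have *: "list_all2 (\<lambda>g. computes g xs) (g # gs) ys \<longleftrightarrow>
        0 < length ys \<and> computes g xs (hd ys) \<and> list_all2 (\<lambda>g. computes g xs) gs (tl ys)" for xs ys
      by (cases ys) auto
    have 1: "semidec (\<lambda>p. computes g (fst p) (hd (snd p)))"
      using semidec_comp[OF Cons.prems(1)[of g], of "\<lambda>p. (fst p, hd (snd p))"]
      by (simp add: crec_intros)
    have 2: "semidec (\<lambda>p. list_all2 (\<lambda>g. computes g (fst p)) gs (tl (snd p)))"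
      using semidec_comp[OF Cons.IH[OF Cons.prems], of "\<lambda>p. (fst p, tl (snd p))"]
      by (simp add: crec_intros)
    show ?case unfolding *
      by (intro semidec_conj 1 2 semidec_decidable decidable_intros crec_intros)
  qed
  have *: "computes (Comp f gs) xs z \<longleftrightarrow> (\<exists>ys. list_all2 (\<lambda>g. computes g xs) gs ys \<and> computes f ys z)" for xs z
  proof
    assume "computes (Comp f gs) xs z"
    then obtain ys where "length ys = length gs" "\<forall>i<length gs. computes (gs ! i) xs (ys ! i)" "computes f ys z"
      by (cases rule: computes.cases) auto
    then show "\<exists>ys. list_all2 (\<lambda>g. computes g xs) gs ys \<and> computes f ys z"
      by (intro exI[of _ ys]) (auto simp: list_all2_conv_all_nth)
  qed (auto simp: list_all2_conv_all_nth intro: computes.comp)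
  have 1: "semidec (\<lambda>p. list_all2 (\<lambda>g. computes g (fst (fst p))) gs (snd p))"
    using semidec_comp[OF gs, of "\<lambda>p. (fst (fst p), snd p)"] by (simp add: crec_intros)
  have 2: "semidec (\<lambda>p. computes f (snd p) (snd (fst p)))"
    using semidec_comp[OF Comp.IH(1), of "\<lambda>p. (snd p, snd (fst p))"] by (simp add: crec_intros)
  show ?case unfolding *
    by (intro semidec_intros 1 2)
next
  case (PrimRec f g)
  have *: "computes (PrimRec f g) xs z \<longleftrightarrow>
     (0 < length xs \<and> (\<exists>ys. length ys = Suc (hd xs) \<and> computes f (tl xs) (hd ys) \<and>
        entry ys (hd xs) = z \<and> (\<forall>k<hd xs. computes g (k # entry ys k # tl xs) (entry ys (Suc k)))))"
    (is "_ \<longleftrightarrow> ?R xs z") for xs z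
  proof
    have "\<exists>ys. length ys = Suc n \<and> computes f us (hd ys) \<and> entry ys n = z \<and>
        (\<forall>k<n. computes g (k # entry ys k # us) (entry ys (Suc k)))"
      if "computes (PrimRec f g) (n # us) z" for n us z
      using that
    proof (induction n arbitrary: z)
      case 0
      then have "computes f us z" by (auto elim: computes.cases)
      then show ?case by (intro exI[of _ "[z]"]) auto
    next
      case (Suc n)
      from Suc.prems obtain y where y: "computes (PrimRec f g) (n # us) y" "computes g (n # y # us) z"
        by (cases rule: computes.cases) auto
      from Suc.IH[OF y(1)] obtain ys where ys: "length ys = Suc n" "computes f us (hd ys)" "entry ys n = y"
        "\<forall>k<n. computes g (k # entry ys k # us) (entry ys (Suc k))" by auto
      show ?case
      proof (intro exI[of _ "ys @ [z]"] conjI allI impI)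
        show "computes f us (hd (ys @ [z]))" using ys by (cases ys) auto
        fix k assume k: "k < Suc n"
        show "computes g (k # entry (ys @ [z]) k # us) (entry (ys @ [z]) (Suc k))"
        proof (cases "k = n")
          case True
          then show ?thesis using y ys by (simp add: hd_append)
        next
          case False
          then show ?thesis using k ys by (auto simp: hd_append)
        qed
      qed (use ys in auto)
    qed
    moreover assume "computes (PrimRec f g) xs z"
    moreover from this have "xs \<noteq> []" by (auto elim: computes.cases)
    ultimately show "?R xs z" by (cases xs) auto
  next
    assume R: "?R xs z"
    then obtain n us where xs: "xs = n # us" by (cases xs) auto
    from R obtain ys where ys: "length ys = Suc n" "computes f us (hd ys)" "entry ys n = z"
        "\<And>k. k < n \<Longrightarrow> computes g (k # entry ys k # us) (entry ys (Suc k))" by (auto simp: xs)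
    have "computes (PrimRec f g) (m # us) (entry ys m)" if "m \<le> n" for m
      using that
    proof (induction m)
      case 0
      then show ?case using ys by (auto intro: computes.prim_0)
    next
      case (Suc m)
      then show ?case using ys(4)[of m] by (auto intro: computes.prim_Suc)
    qed
    then show "computes (PrimRec f g) xs z" using ys(3) by (auto simp: xs)
  qed
  have 1: "semidec (\<lambda>p. computes f (tl (fst (fst p))) (hd (snd p)))"
    using semidec_comp[OF PrimRec.IH(1), of "\<lambda>p. (tl (fst (fst p)), hd (snd p))"] by (simp add: crec_intros)
  have 2: "semidec (\<lambda>p. computes g (snd p # entry (snd (fst p)) (snd p) # tl (fst (fst (fst p)))) (entry (snd (fst p)) (Suc (snd p))))"
    using semidec_comp[OF PrimRec.IH(2), of "\<lambda>p. (snd p # entry (snd (fst p)) (snd p) # tl (fst (fst (fst p))), entry (snd (fst p)) (Suc (snd p)))"]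
    by (simp add: crec_intros)
  show ?case unfolding *
    by (intro semidec_intros 1 2 crec_intros; intro semidec_decidable decidable_intros crec_intros)
next
  case (Mu f)
  have *: "computes (Mu f) xs n \<longleftrightarrow> computes f (n # xs) 0 \<and> (\<forall>m<n. \<exists>y. computes f (m # xs) (Suc y))" for xs n
    by (auto intro: computes.mu elim: computes.cases)
  have 1: "semidec (\<lambda>p. computes f (snd p # fst p) 0)"
    using semidec_comp[OF Mu.IH, of "\<lambda>p. (snd p # fst p, 0)"] by (simp add: crec_intros)
  have 2: "semidec (\<lambda>p. computes f (snd (fst p) # fst (fst (fst p))) (Suc (snd p)))"
    using semidec_comp[OF Mu.IH, of "\<lambda>p. (snd (fst p) # fst (fst (fst p)), Suc (snd p))"]
    by (simp add: crec_intros)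
  show ?case unfolding *
    by (intro semidec_intros 1 2 crec_intros)
qed

lemma semidec_computes':
  assumes "crec u" "crec v"
  shows "semidec (\<lambda>x. computes f (u x) (v x))"
  using semidec_comp[OF semidec_computes crec_Pair[OF assms]] by simp

lemma semidec_enumerated:
  assumes "crec u" "crec v"
  shows "semidec (\<lambda>x. v x \<in> enumerated f (u x))"
  unfolding enumerated_def mem_Collect_eq
  by (intro semidec_intros semidec_computes' crec_intros crec_comp[OF assms(1)] crec_comp[OF assms(2)])

text \<open>A stage \<open>k\<close> is read as a candidate together with a witness. Minimisation
  searches for the number equal to the candidate, accepting it only if the witness is correct.
  Otherwise it diverges, and by the convention of \<open>enumerated\<close> that stage outputs
  nothing.\<close>

lemma re_set_semidec:
  assumes "semidec P"
  shows "re_set {enc x | x. P x}"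
proof -
  obtain D where D: "\<And>u v. crec u \<Longrightarrow> crec v \<Longrightarrow> decidable (\<lambda>x :: nat \<times> nat. D (u x) (v x))"
    "\<And>x. P x \<longleftrightarrow> (\<exists>t::nat. D x t)" using semidecE[OF assms] by blast
  define h where "h = (\<lambda>p :: nat \<times> nat. if D (dcd (fst (dcd (snd p) :: nat \<times> nat))) (snd (dcd (snd p) :: nat \<times> nat))
      \<and> fst p = fst (dcd (snd p) :: nat \<times> nat) then 0 else 1 :: nat)"
  have "crec h" unfolding h_def
    by (intro crec_if decidable_conj decidable_eq D(1) crec_intros)
  then obtain H where H: "\<And>p. computes H [enc p] (h p)" unfolding crec_def enc_nat_def by blast
  let ?H = "Comp H [pair_rf]"
  have H': "computes ?H [m, k] (h (m, k))" for m k
    using computes_Comp1[OF computes_pair_rf, of H m k] H[of "(m, k)"] by simp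
  have "computes (Mu ?H) [k] y \<longleftrightarrow> D (dcd (fst (dcd k :: nat \<times> nat))) (snd (dcd k :: nat \<times> nat)) \<and> y = fst (dcd k :: nat \<times> nat)"
    (is "_ \<longleftrightarrow> ?R k y") for k y
  proof
    assume "computes (Mu ?H) [k] y"
    then have "computes ?H [y, k] 0" by (auto elim: computes.cases)
    then have "h (y, k) = 0" using H' computes_unique by blast
    then show "?R k y" by (auto simp: h_def split: if_splits)
  next
    assume R: "?R k y"
    then have "h (y, k) = 0" by (simp add: h_def)
    then have "computes ?H [y, k] 0" using H'[of y k] by simp
    moreover have "computes ?H [m, k] (Suc 0)" if "m < y" for m
      using H'[of m k] that R by (simp add: h_def)
    ultimately show "computes (Mu ?H) [k] y"
      by (auto intro!: computes.mu)
  qed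
  then have "y \<in> enumerated (Mu ?H) [] \<longleftrightarrow> (\<exists>c t. D (dcd c) t \<and> y = c)" for y
    using ex_dcd_iff[of "\<lambda>c t. D (dcd c) t \<and> y = c"] by (simp add: enumerated_def)
  moreover have "y \<in> {enc x | x. P x} \<longleftrightarrow> (\<exists>c t. D (dcd c) t \<and> y = c)" for y
    unfolding D(2) mem_Collect_eq by (metis dcd_enc enc_dcd)
  ultimately have "enumerated (Mu ?H) [] = {enc x | x. P x}" by blast
  then show ?thesis unfolding re_set_def by metis
qed


section \<open>Factor maps and conjugacies\<close>

lemma topological_factor_map_compose:
  assumes "topological_factor_map G X a Y b \<pi>" "topological_factor_map G Y b Z c \<rho>"
  shows "topological_factor_map G X a Z c (\<rho> \<circ> \<pi>)"
  unfolding topological_factor_map_def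
proof (intro conjI ballI)
  show "continuous_map X Z (\<rho> \<circ> \<pi>)"
    using assms by (auto simp: topological_factor_map_def intro: continuous_map_compose)
  show "(\<rho> \<circ> \<pi>) ` topspace X = topspace Z"
    using assms unfolding topological_factor_map_def by (metis image_comp)
  fix g x assume "g \<in> carrier G" "x \<in> topspace X"
  moreover from this have "\<pi> x \<in> topspace Y"
    using assms by (auto simp: topological_factor_map_def)
  ultimately show "(\<rho> \<circ> \<pi>) (a g x) = c g ((\<rho> \<circ> \<pi>) x)"
    using assms by (simp add: topological_factor_map_def)
qed

lemma topological_conjugacy_compose:
  assumes "topological_conjugacy G X a Y b \<pi>" "topological_conjugacy G Y b Z c \<rho>"
  shows "topological_conjugacy G X a Z c (\<rho> \<circ> \<pi>)"
  using assms unfolding topological_conjugacy_def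
  by (auto intro: topological_factor_map_compose homeomorphic_map_compose)

lemma topological_conjugacy_inverse:
  assumes "topological_conjugacy G X a Y b \<pi>"
    and a: "\<And>g x. g \<in> carrier G \<Longrightarrow> x \<in> topspace X \<Longrightarrow> a g x \<in> topspace X"
  obtains \<pi>' where "topological_conjugacy G Y b X a \<pi>'" "\<And>x. x \<in> topspace X \<Longrightarrow> \<pi>' (\<pi> x) = x"
    "\<And>y. y \<in> topspace Y \<Longrightarrow> \<pi> (\<pi>' y) = y"
proof -
  have fac: "topological_factor_map G X a Y b \<pi>" and hom: "homeomorphic_map X Y \<pi>"
    using assms(1) by (auto simp: topological_conjugacy_def)
  obtain \<pi>' where \<pi>': "homeomorphic_maps X Y \<pi> \<pi>'"
    using hom homeomorphic_map_maps by blast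
  then have inv: "\<And>x. x \<in> topspace X \<Longrightarrow> \<pi>' (\<pi> x) = x" "\<And>y. y \<in> topspace Y \<Longrightarrow> \<pi> (\<pi>' y) = y"
    by (auto simp: homeomorphic_maps_def)
  have hom': "homeomorphic_map Y X \<pi>'"
    using \<pi>' homeomorphic_maps_map by blast
  have "\<pi>' (b g y) = a g (\<pi>' y)" if "g \<in> carrier G" "y \<in> topspace Y" for g y
  proof -
    have x: "\<pi>' y \<in> topspace X"
      using hom' that(2) homeomorphic_imp_surjective_map by blast
    then have "b g y = \<pi> (a g (\<pi>' y))"
      using fac that inv by (simp add: topological_factor_map_def)
    then show ?thesis using inv(1)[OF a[OF that(1) x]] by simp
  qed
  then have "topological_conjugacy G Y b X a \<pi>'"
    using hom' by (auto simp: topological_conjugacy_def topological_factor_map_def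
        homeomorphic_imp_continuous_map homeomorphic_imp_surjective_map)
  then show ?thesis using that inv by blast
qed

lemma (in group_action) action_closed: "g \<in> carrier G \<Longrightarrow> x \<in> E \<Longrightarrow> \<phi> g x \<in> E"
  using surj_prop by blast

lemma (in group_action) action_one: "x \<in> E \<Longrightarrow> \<phi> \<one> x = x"
  by (simp flip: id_eq_one)

lemma (in group_action) action_inv:
  assumes "g \<in> carrier G" "x \<in> E"
  shows "\<phi> (inv g) (\<phi> g x) = x"
proof -
  interpret group G using group_hom by (simp add: group_hom_def)
  have "\<phi> (inv g) (\<phi> g x) = \<phi> (inv g \<otimes> g) x"
    using composition_rule[of x "inv g" g] assms by simp
  then show ?thesis using assms by (simp add: action_one)
qed


section \<open>Symbolic codings along a closed cover\<close>

text \<open>This is the topological half of the argument. The condition \<open>separating\<close> is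
  all that is used of a generating cover: two points that share a member of the cover under every
  group element coincide.\<close>

locale closed_coding = group G for G (structure) +
  fixes T :: "'z topology" and b :: "'a \<Rightarrow> 'z \<Rightarrow> 'z" and n :: nat and C :: "nat \<Rightarrow> 'z set"
  assumes compact: "compact_space T" and hausdorff: "Hausdorff_space T"
    and action: "group_action G (topspace T) b"
    and action_continuous: "g \<in> carrier G \<Longrightarrow> continuous_map T T (b g)"
    and closed_members: "i < n \<Longrightarrow> closedin T (C i)"
    and cover: "topspace T = (\<Union>i<n. C i)"
    and separating: "z \<in> topspace T \<Longrightarrow> z' \<in> topspace T \<Longrightarrow>
      (\<And>g. g \<in> carrier G \<Longrightarrow> \<exists>i<n. b g z \<in> C i \<and> b g z' \<in> C i) \<Longrightarrow> z = z'"
begin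

interpretation act: group_action G "topspace T" b
  by (rule action)

definition codes :: "('a \<Rightarrow> nat) \<Rightarrow> 'z \<Rightarrow> bool" where
  "codes x z \<longleftrightarrow> x \<in> carrier G \<rightarrow>\<^sub>E {..<n} \<and> z \<in> topspace T \<and> (\<forall>g\<in>carrier G. b (inv g) z \<in> C (x g))"

definition coding_shift :: "('a \<Rightarrow> nat) set" where
  "coding_shift = {x. \<exists>z. codes x z}"

definition coded_point :: "('a \<Rightarrow> nat) \<Rightarrow> 'z" where
  "coded_point x = (THE z. codes x z)"

text \<open>The symbol of \<open>x\<close> at \<open>inv g\<close> names a member containing both
  \<open>b g z\<close> and \<open>b g z'\<close>.\<close>

lemma codes_unique:
  assumes "codes x z" "codes x z'"
  shows "z = z'"
proof (rule separating)
  fix g assume g: "g \<in> carrier G"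
  have "b g u \<in> C (x (inv g))" if "codes x u" for u
    using that g inv_closed[OF g] unfolding codes_def by (metis inv_inv)
  moreover have "x (inv g) < n"
    using assms g by (auto simp: codes_def)
  ultimately show "\<exists>i<n. b g z \<in> C i \<and> b g z' \<in> C i" using assms by blast
qed (use assms in \<open>auto simp: codes_def\<close>)

lemma coded_point_eq: "codes x z \<Longrightarrow> coded_point x = z"
  unfolding coded_point_def by (rule the_equality) (auto intro: codes_unique)

text \<open>Applying \<open>inv h\<close> to \<open>b g z\<close> amounts to applying the inverse of
  \<open>inv g \<otimes> h\<close> to \<open>z\<close>, and \<open>inv g \<otimes> h\<close> is the
  position that the left shift reads. This dictates the inverse in \<open>codes\<close>.\<close>

lemma codes_shift:
  assumes "codes x z" "g \<in> carrier G"
  shows "codes (shift G g x) (b g z)"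
  unfolding codes_def
proof (intro conjI ballI)
  show "shift G g x \<in> carrier G \<rightarrow>\<^sub>E {..<n}"
    using assms by (auto simp: codes_def shift_def PiE_iff)
  show "b g z \<in> topspace T"
    using assms act.action_closed by (auto simp: codes_def)
  fix h assume h: "h \<in> carrier G"
  have "b (inv h) (b g z) = b (inv h \<otimes> g) z"
    using assms h act.composition_rule by (auto simp: codes_def)
  also have "inv h \<otimes> g = inv (inv g \<otimes> h)"
    using assms h by (simp add: inv_mult_group)
  finally show "b (inv h) (b g z) \<in> C (shift G g x h)"
    using assms h by (auto simp: codes_def shift_def)
qed

lemma ex_codes:
  assumes "z \<in> topspace T"
  obtains x where "codes x z"
proof -
  have "\<exists>i<n. b (inv g) z \<in> C i" if "g \<in> carrier G" for g
    using act.action_closed[of "inv g" z] that assms cover by auto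
  then obtain f where f: "\<And>g. g \<in> carrier G \<Longrightarrow> f g < n \<and> b (inv g) z \<in> C (f g)" by metis
  have "codes (restrict f (carrier G)) z"
    using f assms by (auto simp: codes_def)
  then show ?thesis using that by blast
qed

lemma topspace_full_shift [simp]: "topspace (full_shift G A) = carrier G \<rightarrow>\<^sub>E A"
  by (simp add: full_shift_def)

text \<open>At a single \<open>g\<close> the condition is a finite union over the symbols
  \<open>i\<close>, each part being cut out by two closed conditions, one on the symbol and one on
  the point.\<close>

lemma closedin_codes: "closedin (prod_topology (full_shift G {..<n}) T) {p. codes (fst p) (snd p)}"
proof -
  let ?P = "prod_topology (full_shift G {..<n}) T"
  have "closedin ?P {p \<in> topspace ?P. b (inv g) (snd p) \<in> C (fst p g)}" if g: "g \<in> carrier G" for g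
  proof -
    have 1: "continuous_map ?P (discrete_topology {..<n}) (\<lambda>p. fst p g)"
      using continuous_map_compose[OF continuous_map_fst
          continuous_map_product_projection[OF g, of "\<lambda>_. discrete_topology {..<n}"]]
      by (simp add: full_shift_def comp_def)
    have 2: "continuous_map ?P T (\<lambda>p. b (inv g) (snd p))"
      using continuous_map_compose[OF continuous_map_snd action_continuous[of "inv g"]] g
      by (auto simp: comp_def)
    have "closedin ?P ({p \<in> topspace ?P. fst p g \<in> {i}} \<inter> {p \<in> topspace ?P. b (inv g) (snd p) \<in> C i})"
      if "i < n" for i
      using that by (intro closedin_Int closedin_continuous_map_preimage[OF 1]
          closedin_continuous_map_preimage[OF 2] closed_members) simp_all
    then have "closedin ?P (\<Union>i<n. {p \<in> topspace ?P. fst p g \<in> {i}} \<inter> {p \<in> topspace ?P. b (inv g) (snd p) \<in> C i})"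
      by (intro closedin_Union) blast+
    moreover have "(\<Union>i<n. {p \<in> topspace ?P. fst p g \<in> {i}} \<inter> {p \<in> topspace ?P. b (inv g) (snd p) \<in> C i})
        = {p \<in> topspace ?P. b (inv g) (snd p) \<in> C (fst p g)}"
    proof -
      have "fst p g < n" if "p \<in> topspace ?P" for p
        using that g by (auto simp: mem_Times_iff)
      then show ?thesis by blast
    qed
    ultimately show ?thesis by simp
  qed
  then have "closedin ?P (\<Inter>g\<in>carrier G. {p \<in> topspace ?P. b (inv g) (snd p) \<in> C (fst p g)})"
    by (intro closedin_INT) auto
  moreover have "(\<Inter>g\<in>carrier G. {p \<in> topspace ?P. b (inv g) (snd p) \<in> C (fst p g)}) = {p. codes (fst p) (snd p)}"
    \<comment> \<open>The group is nonempty, so the intersection stays inside the product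
      space.\<close>
    using one_closed by (auto simp only: codes_def INT_iff mem_Collect_eq topspace_prod_topology
        topspace_full_shift mem_Times_iff)
  ultimately show ?thesis by simp
qed

lemma compact_full_shift: "compact_space (full_shift G {..<n})"
  by (simp add: full_shift_def compact_space_product_topology compact_space_discrete_topology)

lemma hausdorff_full_shift: "Hausdorff_space (full_shift G {..<n})"
  by (simp add: full_shift_def Hausdorff_space_product_topology)

text \<open>The set is the first projection of a compact set, and its target is Hausdorff. With
  \<open>Q\<close> the whole space this shows that \<open>coding_shift\<close> is closed; for other
  \<open>Q\<close> it is the preimage under \<open>coded_point\<close>, whence continuity.\<close>

lemma closedin_projection:
  assumes "closedin T Q"
  shows "closedin (full_shift G {..<n}) {x. \<exists>z\<in>Q. codes x z}"
proof -
  let ?P = "prod_topology (full_shift G {..<n}) T"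
  have "closedin ?P ({p. codes (fst p) (snd p)} \<inter> {p \<in> topspace ?P. snd p \<in> Q})"
    by (intro closedin_Int closedin_codes closedin_continuous_map_preimage[OF continuous_map_snd assms])
  then have "compactin ?P ({p. codes (fst p) (snd p)} \<inter> {p \<in> topspace ?P. snd p \<in> Q})"
    by (intro closedin_compact_space) (auto simp: compact_space_prod_topology compact_full_shift compact)
  then have "compactin (full_shift G {..<n}) (fst ` ({p. codes (fst p) (snd p)} \<inter> {p \<in> topspace ?P. snd p \<in> Q}))"
    using image_compactin continuous_map_fst by blast
  moreover have "fst ` ({p. codes (fst p) (snd p)} \<inter> {p \<in> topspace ?P. snd p \<in> Q}) = {x. \<exists>z\<in>Q. codes x z}"
    (is "fst ` ?E = ?R")
  proof
    show "fst ` ?E \<subseteq> ?R" by blast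
    have "(x, z) \<in> ?E" if "codes x z" "z \<in> Q" for x z
      using that by (simp add: codes_def)
    then have "x \<in> fst ` ?E" if "codes x z" "z \<in> Q" for x z
      by (rule image_eqI[rotated]) (use that in simp_all)
    then show "?R \<subseteq> fst ` ?E" by blast
  qed
  ultimately show ?thesis
    using compactin_imp_closedin[OF hausdorff_full_shift] by simp
qed

lemma coding_shift_eq: "coding_shift = {x. \<exists>z\<in>topspace T. codes x z}"
  by (auto simp: coding_shift_def codes_def)

lemma subshift_coding_shift: "subshift G {..<n} coding_shift"
  unfolding subshift_def
proof (intro conjI ballI)
  show "closedin (full_shift G {..<n}) coding_shift"
    unfolding coding_shift_eq by (rule closedin_projection) simp
  fix g assume "g \<in> carrier G"
  then show "shift G g ` coding_shift \<subseteq> coding_shift"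
    using codes_shift by (auto simp: coding_shift_def)
qed simp

lemma topspace_coding_shift: "topspace (subtopology (full_shift G {..<n}) coding_shift) = coding_shift"
  by (auto simp: coding_shift_def codes_def)

lemma factor_map_coded_point:
  "topological_factor_map G (subtopology (full_shift G {..<n}) coding_shift) (shift G) T b coded_point"
  unfolding topological_factor_map_def topspace_coding_shift
proof (intro conjI ballI)
  show "continuous_map (subtopology (full_shift G {..<n}) coding_shift) T coded_point"
    unfolding continuous_map_closedin topspace_coding_shift
  proof (intro conjI allI impI)
    show "coded_point \<in> coding_shift \<rightarrow> topspace T"
      by (auto simp: coding_shift_def coded_point_eq) (simp add: codes_def)
    fix Q assume Q: "closedin T Q"
    have "{x \<in> coding_shift. coded_point x \<in> Q} = {x. \<exists>z\<in>Q. codes x z}"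
      by (auto simp: coding_shift_def coded_point_eq)
    then show "closedin (subtopology (full_shift G {..<n}) coding_shift) {x \<in> coding_shift. coded_point x \<in> Q}"
      using closedin_projection[OF Q] by (auto simp: closedin_subtopology)
  qed
  show "coded_point ` coding_shift = topspace T"
  proof
    show "topspace T \<subseteq> coded_point ` coding_shift"
    proof
      fix z assume "z \<in> topspace T"
      then obtain x where "codes x z" by (rule ex_codes)
      then show "z \<in> coded_point ` coding_shift"
        using coded_point_eq by (force simp: coding_shift_def)
    qed
  qed (auto simp: coding_shift_def coded_point_eq codes_def)
  fix g x assume "g \<in> carrier G" "x \<in> coding_shift"
  then show "coded_point (shift G g x) = b g (coded_point x)"
    using codes_shift by (auto simp: coding_shift_def coded_point_eq)
qed

text \<open>Disjointness lets the point determine its symbol at each \<open>g\<close>. Then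
  \<open>coded_point\<close> is a continuous bijection from a compact space to a Hausdorff
  space.\<close>

lemma conjugacy_coding_shift:
  assumes disjoint: "\<And>i j. i < n \<Longrightarrow> j < n \<Longrightarrow> i \<noteq> j \<Longrightarrow> C i \<inter> C j = {}"
  shows "\<exists>\<pi>. topological_conjugacy G T b (subtopology (full_shift G {..<n}) coding_shift) (shift G) \<pi>"
proof -
  let ?Y = "subtopology (full_shift G {..<n}) coding_shift"
  have "x = x'" if "codes x z" "codes x' z" for x x' z
  proof -
    have "x g = x' g" if g: "g \<in> carrier G" for g
    proof -
      have "x g < n" "x' g < n" "C (x g) \<inter> C (x' g) \<noteq> {}"
        using that \<open>codes x z\<close> \<open>codes x' z\<close> by (auto simp: codes_def)
      then show ?thesis using disjoint by blast
    qed
    then show ?thesis using that unfolding codes_def by (blast intro: PiE_ext)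
  qed
  then have "inj_on coded_point coding_shift"
    by (auto simp: inj_on_def coding_shift_def coded_point_eq)
  then have "homeomorphic_map ?Y T coded_point"
    using factor_map_coded_point subshift_coding_shift
    by (intro continuous_imp_homeomorphic_map)
       (auto simp: topspace_coding_shift topological_factor_map_def hausdorff subshift_def
         intro!: compact_space_subtopology closedin_compact_space compact_full_shift
         simp del: topspace_subtopology)
  then have "topological_conjugacy G ?Y (shift G) T b coded_point"
    using factor_map_coded_point by (simp add: topological_conjugacy_def)
  moreover have "shift G g x \<in> topspace ?Y" if "g \<in> carrier G" "x \<in> topspace ?Y" for g x
    using that codes_shift unfolding topspace_coding_shift by (auto simp: coding_shift_def)
  ultimately obtain \<pi> where "topological_conjugacy G T b ?Y (shift G) \<pi>"
    by (rule topological_conjugacy_inverse)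
  then show ?thesis by blast
qed

end


section \<open>Effective maps on recursively compact sets\<close>

lemma dcd_nat_pair: "dcd n = (prod_decode n :: nat \<times> nat)"
proof -
  have "enc (prod_decode n) = n"
    by (simp add: enc_prod_def)
  then show ?thesis by (metis dcd_enc)
qed

section \<open>Rational codes and their comparison\<close>

lemma posrat_of_code_pos: "0 < posrat_of_code q"
  by (auto simp: posrat_of_code_def split: prod.split)

lemma ex_posrat_less:
  assumes "0 < (\<epsilon>::real)"
  obtains q where "posrat_of_code q < \<epsilon>"
proof -
  obtain n where "inverse (real (Suc n)) < \<epsilon>" using reals_Archimedean[OF assms] by blast
  then have "posrat_of_code (prod_encode (0, n)) < \<epsilon>"
    by (simp add: posrat_of_code_def divide_inverse)
  then show ?thesis using that by blast
qed

text \<open>\<open>int_decode\<close> sends the even codes to the nonnegative integers. Positive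
  rationals thus have numerators \<open>h\<close> in the naturals, where comparison is already known
  to be decidable.\<close>

lemma rat_of_code_even: "rat_of_code (prod_encode (2 * h, b)) = real h / real (Suc b)"
  by (simp add: rat_of_code_def int_decode_def sum_decode_def)

lemma rat_of_code_pos_even:
  assumes "0 < rat_of_code c"
  obtains h b where "c = prod_encode (2 * h, b)"
proof -
  obtain a b where c: "c = prod_encode (a, b)" by (metis prod_decode_inverse surj_pair)
  have "0 < int_decode a"
    using assms by (simp add: c rat_of_code_def zero_less_divide_iff)
  then have "even a"
    by (auto simp: int_decode_def sum_decode_def split: if_splits)
  then show ?thesis using c that by (auto elim: evenE)
qed

text \<open>Denominators are cleared to reach a decidable comparison of naturals. The summand
  \<open>1 / real (Suc n)\<close> will be the error allowed for an approximate distance, the other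
  two summands will be radii.\<close>

lemma rational_sum_less_iff:
  "1 / real (Suc n) + real (Suc p) / real (Suc p') + real (Suc q) / real (Suc q') < real h / real (Suc b) \<longleftrightarrow>
   Suc b * (Suc p' * Suc q' + Suc p * Suc n * Suc q' + Suc q * Suc n * Suc p') < h * (Suc n * Suc p' * Suc q')"
proof -
  define N P P' Q Q' B where "N = real (Suc n)" "P = real (Suc p)" "P' = real (Suc p')"
    "Q = real (Suc q)" "Q' = real (Suc q')" "B = real (Suc b)"
  note defs = this
  have pos: "N > 0" "P' > 0" "Q' > 0" "B > 0" by (auto simp: defs)
  have "1 / N + P / P' + Q / Q' = (P' * Q' + P * N * Q' + Q * N * P') / (N * P' * Q')"
    using pos by (simp add: field_simps)
  have "1 / N + P / P' + Q / Q' < real h / B \<longleftrightarrow>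
      B * (P' * Q' + P * N * Q' + Q * N * P') < real h * (N * P' * Q')"
  proof -
    have frac: "x / y < u / v \<longleftrightarrow> v * x < u * y" if "y > 0" "v > 0" for x y u v :: real
      using that by (simp add: field_simps)
    show ?thesis
      unfolding \<open>1 / N + P / P' + Q / Q' = _\<close> using pos by (intro frac) simp_all
  qed
  also have "\<dots> \<longleftrightarrow> real (Suc b * (Suc p' * Suc q' + Suc p * Suc n * Suc q' + Suc q * Suc n * Suc p'))
      < real (h * (Suc n * Suc p' * Suc q'))"
    unfolding defs by (simp only: of_nat_mult of_nat_add)
  finally show ?thesis by (simp only: defs of_nat_less_iff)
qed

section \<open>Recursively compact sets and effective maps on them\<close>

locale rec_compact_set = Metric_space M d for M :: "'m set" and d +
  fixes s :: "nat \<Rightarrow> 'm" and K :: "'m set"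
  assumes computable_metric: "computable_metric_space M d s"
    and rec_compact: "recursively_compact M d s K"
begin

abbreviation "bball \<equiv> basic_ball M d s"
abbreviation "balls \<equiv> ball_union M d s"
abbreviation "KT \<equiv> subtopology mtopology K"

lemma compactin_K: "compactin mtopology K"
  using rec_compact by (simp add: recursively_compact_def)

lemma K_subset: "K \<subseteq> M"
  using compactin_subset_topspace[OF compactin_K] by simp

lemma topspace_KT: "topspace KT = K"
  using K_subset by auto

lemma s_in: "s i \<in> M"
  using computable_metric by (auto simp: computable_metric_space_def)

lemma in_bball: "z \<in> bball (prod_encode (j, q)) \<longleftrightarrow> z \<in> M \<and> d (s j) z < posrat_of_code q"
  by (simp add: basic_ball_def s_in)

lemma openin_bball: "openin mtopology (bball k)"
  by (simp add: basic_ball_def split: prod.split)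

lemma balls_mono: "I \<subseteq> J \<Longrightarrow> balls I \<subseteq> balls J"
  by (auto simp: ball_union_def)

lemma openin_balls: "openin mtopology (balls I)"
  unfolding ball_union_def by (intro openin_Union) (auto simp: openin_bball)

lemma ex_small_ball:
  assumes "y \<in> M" "0 < \<epsilon>"
  obtains j q where "posrat_of_code q < \<epsilon>" "d (s j) y < posrat_of_code q"
proof -
  obtain q where q: "posrat_of_code q < \<epsilon>" using ex_posrat_less[OF assms(2)] .
  have "y \<in> mtopology closure_of range s"
    using computable_metric assms by (simp add: computable_metric_space_def)
  then obtain j where "s j \<in> mball y (posrat_of_code q)"
    using posrat_of_code_pos by (auto simp: metric_closure_of)
  then have "d (s j) y < posrat_of_code q" by (simp add: commute)
  with q show ?thesis using that by blast
qed

lemma ex_bball_in_open: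
  assumes "openin mtopology U" "y \<in> U"
  obtains k where "y \<in> bball k" "bball k \<subseteq> U"
proof -
  obtain \<epsilon> where \<epsilon>: "\<epsilon> > 0" "mball y \<epsilon> \<subseteq> U" and y: "y \<in> M"
    using assms openin_mtopology by blast
  obtain j q where jq: "posrat_of_code q < \<epsilon> / 2" "d (s j) y < posrat_of_code q"
    using ex_small_ball[OF y half_gt_zero[OF \<epsilon>(1)]] by blast
  have "bball (prod_encode (j, q)) \<subseteq> mball y \<epsilon>"
  proof
    fix z assume z: "z \<in> bball (prod_encode (j, q))"
    then have "d y z \<le> d (s j) y + d (s j) z"
      using triangle''[of y "s j" z] y s_in by (simp add: in_bball commute)
    then show "z \<in> mball y \<epsilon>" using z jq y by (simp add: in_bball)
  qed
  then show ?thesis using that[of "prod_encode (j, q)"] \<epsilon> jq y by (auto simp: in_bball)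
qed

lemma finite_ball_cover:
  assumes "compactin mtopology S" "S \<subseteq> balls I"
  obtains ks where "set ks \<subseteq> I" "S \<subseteq> balls (set ks)"
proof -
  have "\<exists>\<F>. finite \<F> \<and> \<F> \<subseteq> bball ` I \<and> S \<subseteq> \<Union>\<F>"
    using assms by (intro compactinD[OF assms(1)]) (auto simp: ball_union_def openin_bball)
  then obtain F where "finite F" "F \<subseteq> I" "S \<subseteq> \<Union>(bball ` F)"
    by (metis finite_subset_image)
  moreover from this obtain ks where "set ks = F" using finite_list by blast
  ultimately show ?thesis using that[of ks] by (auto simp: ball_union_def)
qed

text \<open>By compactness the whole family covers \<open>K\<close> iff a finite list taken from it
  does. Such a list is guessed, its entries are confirmed by \<open>R\<close>, and the program from
  recursive compactness confirms that it covers.\<close>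

lemma semidec_cover:
  assumes "semidec (\<lambda>p. R (fst p) (snd p))"
  shows "semidec (\<lambda>x. K \<subseteq> balls {k. R x k})"
proof -
  obtain f where f: "\<And>ks. halts f [list_encode ks] \<longleftrightarrow> K \<subseteq> balls (set ks)"
    using rec_compact unfolding recursively_compact_def by blast
  have eq: "K \<subseteq> balls {k. R x k} \<longleftrightarrow>
      (\<exists>ks. (\<forall>k\<in>set ks. R x k) \<and> (\<exists>y. computes f [enc ks] y))" for x
  proof
    assume "K \<subseteq> balls {k. R x k}"
    then obtain ks where "set ks \<subseteq> {k. R x k}" "K \<subseteq> balls (set ks)"
      using finite_ball_cover[OF compactin_K] by blast
    then show "\<exists>ks. (\<forall>k\<in>set ks. R x k) \<and> (\<exists>y. computes f [enc ks] y)"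
      using f[of ks] by (auto simp: halts_def enc_nat_list)
  next
    assume "\<exists>ks. (\<forall>k\<in>set ks. R x k) \<and> (\<exists>y. computes f [enc ks] y)"
    then obtain ks where ks: "\<forall>k\<in>set ks. R x k" "K \<subseteq> balls (set ks)"
      using f by (auto simp: halts_def enc_nat_list)
    then show "K \<subseteq> balls {k. R x k}" using balls_mono[of "set ks" "{k. R x k}"] by blast
  qed
  have R: "semidec (\<lambda>p. R (fst (fst p)) (snd p))"
    using semidec_comp[OF assms, of "\<lambda>p. (fst (fst p), snd p)"] by (simp add: crec_intros)
  show ?thesis unfolding eq
    by (intro semidec_intros R semidec_computes' crec_intros)
qed

text \<open>A strict inequality leaves a gap, and some approximation of the distance is fine enough
  to exhibit it.\<close>

lemma semidec_dist_greater:
  assumes "crec i" "crec j" "crec p" "crec q"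
  shows "semidec (\<lambda>x. posrat_of_code (p x) + posrat_of_code (q x) < d (s (i x)) (s (j x)))"
proof -
  obtain f where f: "\<And>i j n. \<exists>c. computes f [i, j, n] c \<and> \<bar>d (s i) (s j) - rat_of_code c\<bar> \<le> 1 / 2 ^ n"
    using computable_metric unfolding computable_metric_space_def by blast
  \<comment> \<open>The weaker error bound spares a program for exponentiation.\<close>
  have pow: "1 / 2 ^ n \<le> 1 / real (Suc n)" for n
  proof -
    have "Suc n \<le> 2 ^ n" by (induction n) auto
    then have "real (Suc n) \<le> 2 ^ n" by (metis of_nat_le_iff of_nat_numeral of_nat_power)
    then show ?thesis by (intro divide_left_mono) auto
  qed
  have f': "\<bar>d (s i) (s j) - rat_of_code c\<bar> \<le> 1 / real (Suc n)" if "computes f [i, j, n] c" for i j n c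
    using f[of i j n] computes_unique[OF that] pow[of n] by (metis order_trans)
  define less where "less = (\<lambda>n h b p q. Suc b * (Suc (snd p) * Suc (snd q) + Suc (fst p) * Suc n * Suc (snd q)
      + Suc (fst q) * Suc n * Suc (snd p)) < h * (Suc n * Suc (snd p) * Suc (snd q)))"
  have less: "less n h b (dcd p) (dcd q) \<longleftrightarrow>
      1 / real (Suc n) + posrat_of_code p + posrat_of_code q < rat_of_code (prod_encode (2 * h, b))" for n h b p q
    unfolding less_def rational_sum_less_iff[symmetric] rat_of_code_even posrat_of_code_def dcd_nat_pair
    by (simp add: split_beta)
  have eq: "posrat_of_code p + posrat_of_code q < d (s i) (s j) \<longleftrightarrow>
      (\<exists>n h b. computes f [i, j, n] (enc (2 * h, b)) \<and> less n h b (dcd p) (dcd q))" for i j p q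
  proof
    assume "posrat_of_code p + posrat_of_code q < d (s i) (s j)"
    \<comment> \<open>Half of the gap, because the error is spent twice: in the approximation and as
      the margin demanded by \<open>less\<close>.\<close>
    then have "0 < (d (s i) (s j) - (posrat_of_code p + posrat_of_code q)) / 2" by simp
    then obtain n where n: "inverse (real (Suc n)) < (d (s i) (s j) - (posrat_of_code p + posrat_of_code q)) / 2"
      using reals_Archimedean by blast
    obtain c where c: "computes f [i, j, n] c" using f by blast
    have "1 / real (Suc n) + posrat_of_code p + posrat_of_code q < rat_of_code c"
      using f'[OF c] n by (simp add: inverse_eq_divide)
    moreover from this have "0 < rat_of_code c"
      using posrat_of_code_pos[of p] posrat_of_code_pos[of q]
      by (smt (verit) of_nat_0_le_iff zero_le_divide_1_iff)
    then obtain h b where "c = prod_encode (2 * h, b)" by (rule rat_of_code_pos_even)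
    ultimately show "\<exists>n h b. computes f [i, j, n] (enc (2 * h, b)) \<and> less n h b (dcd p) (dcd q)"
      unfolding less using c by auto
  next
    assume "\<exists>n h b. computes f [i, j, n] (enc (2 * h, b)) \<and> less n h b (dcd p) (dcd q)"
    then obtain n h b where *: "computes f [i, j, n] (prod_encode (2 * h, b))"
      "1 / real (Suc n) + posrat_of_code p + posrat_of_code q < rat_of_code (prod_encode (2 * h, b))"
      unfolding less by auto
    then show "posrat_of_code p + posrat_of_code q < d (s i) (s j)"
      using f'[OF *(1)] by simp
  qed
  show ?thesis
    unfolding eq unfolding less_def
    by (intro semidec_intros semidec_computes' semidec_decidable decidable_intros crec_intros
        crec_comp[OF assms(1)] crec_comp[OF assms(2)] crec_comp[OF assms(3)] crec_comp[OF assms(4)])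
qed

text \<open>For self-maps of \<open>K\<close> this is \<open>computable_map\<close> with a
  semidecidable relation between ball indices in place of an enumerating program. In this form
  composition and inversion need only the closure rules.\<close>

definition eff_map :: "('m \<Rightarrow> 'm) \<Rightarrow> bool" where
  "eff_map h \<longleftrightarrow> h \<in> K \<rightarrow> K \<and>
     (\<exists>R. semidec (\<lambda>p. R (fst p) (snd p)) \<and> (\<forall>m. {z \<in> K. h z \<in> bball m} = balls {k. R m k} \<inter> K))"

lemma eff_map_computable_map:
  assumes "computable_map M d s K M d s h" "h \<in> K \<rightarrow> K"
  shows "eff_map h"
proof -
  obtain e where e: "\<And>m. {z \<in> K. h z \<in> bball m} = balls (enumerated e [m]) \<inter> K"
    using assms(1) unfolding computable_map_def by blast
  have "semidec (\<lambda>p. snd p \<in> enumerated e [fst p])"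
    by (intro semidec_enumerated crec_intros)
  then show ?thesis unfolding eff_map_def using assms(2) e
    by (intro conjI exI[of _ "\<lambda>m k. k \<in> enumerated e [m]"]) auto
qed

lemma eff_map_cong: "eff_map h \<Longrightarrow> (\<And>z. z \<in> K \<Longrightarrow> h' z = h z) \<Longrightarrow> eff_map h'"
  unfolding eff_map_def by (auto cong: conj_cong)

lemma eff_map_id: "eff_map (\<lambda>z. z)"
proof -
  have "semidec (\<lambda>p :: nat \<times> nat. snd p = fst p)"
    by (intro semidec_decidable decidable_intros crec_intros)
  then show ?thesis unfolding eff_map_def
    by (intro conjI exI[of _ "\<lambda>m k. k = m"]) (auto simp: ball_union_def)
qed

lemma eff_map_compose:
  assumes "eff_map g" "eff_map h"
  shows "eff_map (\<lambda>z. g (h z))"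
proof -
  obtain R where R: "semidec (\<lambda>p. R (fst p) (snd p))" "\<And>m. {z \<in> K. g z \<in> bball m} = balls {k. R m k} \<inter> K"
    using assms(1) unfolding eff_map_def by blast
  obtain S where S: "semidec (\<lambda>p. S (fst p) (snd p))" "\<And>m. {z \<in> K. h z \<in> bball m} = balls {k. S m k} \<inter> K"
    using assms(2) unfolding eff_map_def by blast
  have K: "g \<in> K \<rightarrow> K" "h \<in> K \<rightarrow> K" using assms by (auto simp: eff_map_def)
  have R': "z \<in> K \<Longrightarrow> g z \<in> bball m \<longleftrightarrow> (\<exists>k. R m k \<and> z \<in> bball k)" for z m
    using R(2)[of m] by (auto simp: ball_union_def)
  have S': "z \<in> K \<Longrightarrow> h z \<in> bball m \<longleftrightarrow> (\<exists>k. S m k \<and> z \<in> bball k)" for z m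
    using S(2)[of m] by (auto simp: ball_union_def)
  have "semidec (\<lambda>p. \<exists>l. R (fst p) l \<and> S l (snd p))"
    using semidec_comp[OF R(1), of "\<lambda>p :: (nat \<times> nat) \<times> nat. (fst (fst p), snd p)"]
      semidec_comp[OF S(1), of "\<lambda>p :: (nat \<times> nat) \<times> nat. (snd p, snd (fst p))"]
    by (intro semidec_intros) (auto simp: crec_intros)
  moreover have "{z \<in> K. g (h z) \<in> bball m} = balls {k. \<exists>l. R m l \<and> S l k} \<inter> K" for m
  proof (intro Set.set_eqI)
    fix z
    show "z \<in> {z \<in> K. g (h z) \<in> bball m} \<longleftrightarrow> z \<in> balls {k. \<exists>l. R m l \<and> S l k} \<inter> K"
    proof (cases "z \<in> K")
      case True
      then have "h z \<in> K" using K by auto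
      with True show ?thesis by (auto simp: R' S' ball_union_def)
    qed simp
  qed
  ultimately show ?thesis using K unfolding eff_map_def
    by (intro conjI exI[of _ "\<lambda>m k. \<exists>l. R m l \<and> S l k"]) auto
qed

text \<open>
  A ball around a point \<open>y\<close> lies in the preimage of a basic ball \<open>B\<close> under \<open>h\<inverse>\<close> as soon as it is
  disjoint from the compact set \<open>h ` (K - B)\<close>, and by recursive compactness of \<open>K\<close> that is semidecidable.
\<close>

lemma eff_map_inverse:
  assumes h: "eff_map h" and cont: "continuous_map KT KT h"
    and h': "h' \<in> K \<rightarrow> K" and inv: "\<And>z. z \<in> K \<Longrightarrow> h' (h z) = z" "\<And>z. z \<in> K \<Longrightarrow> h (h' z) = z"
  shows "eff_map h'"
proof -
  obtain R where R: "semidec (\<lambda>p. R (fst p) (snd p))" "\<And>m. {z \<in> K. h z \<in> bball m} = balls {k. R m k} \<inter> K"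
    using h unfolding eff_map_def by blast
  have R': "z \<in> K \<Longrightarrow> h z \<in> bball m \<longleftrightarrow> (\<exists>k. R m k \<and> z \<in> bball k)" for z m
    using R(2)[of m] by (auto simp: ball_union_def)
  have hK: "h z \<in> K" if "z \<in> K" for z using h that by (auto simp: eff_map_def)
  define centre radius where "centre = (\<lambda>k. s (fst (dcd k :: nat \<times> nat)))"
    and "radius = (\<lambda>k. posrat_of_code (snd (dcd k :: nat \<times> nat)))"
  have ball: "z \<in> bball k \<longleftrightarrow> z \<in> M \<and> d (centre k) z < radius k" for z k
    using in_bball[of z "fst (prod_decode k)" "snd (prod_decode k)"]
    by (simp add: centre_def radius_def dcd_nat_pair)
  have centre: "centre k \<in> M" for k by (simp add: centre_def s_in)
  \<comment> \<open>\<open>far k l\<close> forces the balls \<open>k\<close> and \<open>l\<close> to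
    be disjoint, and it is semidecidable. The balls far from \<open>k\<close> together fill exactly
    the points at distance greater than \<open>radius k\<close> from the centre of
    \<open>k\<close>.\<close>
  define far where "far = (\<lambda>k l. radius k + radius l < d (centre k) (centre l))"
  have far: "(\<exists>l. far k l \<and> w \<in> bball l) \<longleftrightarrow> radius k < d (centre k) w" if w: "w \<in> M" for k w
  proof
    assume "\<exists>l. far k l \<and> w \<in> bball l"
    then obtain l where l: "far k l" "w \<in> bball l" by blast
    have "d (centre k) (centre l) \<le> d (centre k) w + d w (centre l)"
      using triangle centre w by blast
    then show "radius k < d (centre k) w" using l by (simp add: ball far_def commute)
  next
    assume less: "radius k < d (centre k) w"
    then have "0 < d (centre k) w - radius k" by simp
    then obtain j q where jq: "posrat_of_code q < (d (centre k) w - radius k) / 2" "d (s j) w < posrat_of_code q"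
      using ex_small_ball[OF w half_gt_zero] by blast
    let ?l = "prod_encode (j, q)"
    have l: "centre ?l = s j" "radius ?l = posrat_of_code q"
      by (simp_all add: centre_def radius_def dcd_nat_pair)
    have "d (centre k) w \<le> d (centre k) (s j) + d (s j) w"
      using triangle centre w s_in by blast
    then have "far k ?l" using jq by (simp add: far_def l)
    moreover have "w \<in> bball ?l" using jq w by (simp add: in_bball)
    ultimately show "\<exists>l. far k l \<and> w \<in> bball l" by blast
  qed
  \<comment> \<open>The balls indexed by \<open>R l\<close> describe the preimage of ball
    \<open>l\<close>. The cover therefore expresses that \<open>h\<close> moves every point of
    \<open>K\<close> outside ball \<open>m\<close> farther than \<open>radius k\<close> from the
    centre of \<open>k\<close>.\<close>
  define S where "S = (\<lambda>m k. K \<subseteq> balls {i. i = m \<or> (\<exists>l. far k l \<and> R l i)})"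
  have S: "S m k \<longleftrightarrow> (\<forall>z\<in>K. z \<in> bball m \<or> radius k < d (centre k) (h z))" for m k
  proof -
    have "z \<in> balls {i. i = m \<or> (\<exists>l. far k l \<and> R l i)} \<longleftrightarrow> z \<in> bball m \<or> radius k < d (centre k) (h z)"
      if z: "z \<in> K" for z
    proof -
      have "z \<in> balls {i. i = m \<or> (\<exists>l. far k l \<and> R l i)} \<longleftrightarrow> z \<in> bball m \<or> (\<exists>l. far k l \<and> (\<exists>i. R l i \<and> z \<in> bball i))"
        by (auto simp: ball_union_def)
      also have "\<dots> \<longleftrightarrow> z \<in> bball m \<or> (\<exists>l. far k l \<and> h z \<in> bball l)"
        using R'[OF z] by simp
      finally show ?thesis using far[of "h z" k] hK[OF z] K_subset by auto
    qed
    then show ?thesis unfolding S_def by blast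
  qed
  have "semidec (\<lambda>p. far (fst p) (snd p))"
    unfolding far_def centre_def radius_def by (intro semidec_dist_greater crec_intros)
  from semidec_comp[OF this, of "\<lambda>p :: ((nat \<times> nat) \<times> nat) \<times> nat. (snd (fst (fst p)), snd p)"]
  have 1: "semidec (\<lambda>p :: ((nat \<times> nat) \<times> nat) \<times> nat. far (snd (fst (fst p))) (snd p))"
    by (simp add: crec_intros)
  have 2: "semidec (\<lambda>p :: ((nat \<times> nat) \<times> nat) \<times> nat. R (snd p) (snd (fst p)))"
    using semidec_comp[OF R(1), of "\<lambda>p :: ((nat \<times> nat) \<times> nat) \<times> nat. (snd p, snd (fst p))"] by (simp add: crec_intros)
  have "semidec (\<lambda>p. S (fst p) (snd p))"
    unfolding S_def
    by (intro semidec_cover semidec_disj semidec_ex semidec_conj 1 2 semidec_decidable decidable_eq crec_intros)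
  moreover have "{y \<in> K. h' y \<in> bball m} = balls {k. S m k} \<inter> K" for m
  proof (intro Set.set_eqI iffI)
    fix y assume "y \<in> balls {k. S m k} \<inter> K"
    then obtain k where k: "S m k" "y \<in> bball k" and y: "y \<in> K" by (auto simp: ball_union_def)
    have "h' y \<in> bball m \<or> radius k < d (centre k) (h (h' y))"
      using k(1) y h' by (auto simp: S)
    then show "y \<in> {y \<in> K. h' y \<in> bball m}"
      using k(2) y inv by (simp add: ball)
  next
    fix y assume "y \<in> {y \<in> K. h' y \<in> bball m}"
    then have y: "y \<in> K" "h' y \<in> bball m" by auto
    have "compactin mtopology (K - bball m)"
      by (rule closed_compactin[OF compactin_K Diff_subset
            closedin_diff[OF compactin_imp_closedin[OF Hausdorff_space_mtopology compactin_K] openin_bball]])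
    then have "compactin KT (K - bball m)" by (simp add: compactin_subtopology)
    then have "compactin KT (h ` (K - bball m))" using image_compactin cont by blast
    then have "closedin mtopology (h ` (K - bball m))"
      by (simp add: compactin_subtopology compactin_imp_closedin Hausdorff_space_mtopology)
    moreover have "y \<notin> h ` (K - bball m)" using y inv by auto
    ultimately obtain r where r: "r > 0" "disjnt (h ` (K - bball m)) (mball y r)"
      using y K_subset unfolding closedin_metric by blast
    \<comment> \<open>The bound \<open>r / 2\<close> leaves room for the radius twice: the centre
      may be that far from \<open>y\<close>, and the image of \<open>K - bball m\<close> must still
      be farther than that from the centre.\<close>
    obtain j q where jq: "posrat_of_code q < r / 2" "d (s j) y < posrat_of_code q"
      using ex_small_ball[OF subsetD[OF K_subset y(1)] half_gt_zero[OF r(1)]] by blast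
    let ?k = "prod_encode (j, q)"
    have k: "centre ?k = s j" "radius ?k = posrat_of_code q"
      by (simp_all add: centre_def radius_def dcd_nat_pair)
    have "S m ?k" unfolding S k
    proof (intro ballI)
      fix z assume z: "z \<in> K"
      show "z \<in> bball m \<or> posrat_of_code q < d (s j) (h z)"
      proof (cases "z \<in> bball m")
        case False
        then have "h z \<notin> mball y r" using r z by (auto simp: disjnt_def)
        then have "r \<le> d y (h z)" using y z hK K_subset by auto
        also have "\<dots> \<le> d y (s j) + d (s j) (h z)"
          using triangle y z hK K_subset s_in by blast
        finally show ?thesis using jq by (simp add: commute)
      qed simp
    qed
    moreover have "y \<in> bball ?k" using jq y K_subset by (auto simp: in_bball)
    ultimately show "y \<in> balls {k. S m k} \<inter> K" using y by (auto simp: ball_union_def)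
  qed
  ultimately show ?thesis using h' unfolding eff_map_def by blast
qed

end


section \<open>Effectiveness of codings\<close>

text \<open>Induction on the generation of \<open>g\<close>. The algorithm obtained is not uniform
  in \<open>g\<close>; it will be applied to single letters and their inverses.\<close>

lemma (in rec_compact_set) eff_map_action:
  assumes act: "group_action G K b" and gens: "generating_list G gs"
    and cont: "\<And>g. g \<in> carrier G \<Longrightarrow> continuous_map KT KT (b g)"
    and eff: "\<And>g. g \<in> set gs \<Longrightarrow> eff_map (b g)"
    and g: "g \<in> carrier G"
  shows "eff_map (b g)"
proof -
  interpret act: group_action G K b by (rule act)
  interpret group G using act.group_hom by (simp add: group_hom_def)
  have gs: "set gs \<subseteq> carrier G" using gens by (simp add: generating_list_def)
  have "g \<in> generate G (set gs)" using g gens by (simp add: generating_list_def)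
  then show ?thesis
  proof (induction rule: generate.induct)
    case one
    show ?case by (rule eff_map_cong[OF eff_map_id]) (simp add: act.action_one)
  next
    case (incl h)
    then show ?case by (rule eff)
  next
    case (inv h)
    then have h: "h \<in> carrier G" using gs by blast
    show ?case
    proof (rule eff_map_inverse[OF eff[OF inv] cont[OF h]])
      show "b (inv\<^bsub>G\<^esub> h) \<in> K \<rightarrow> K" using act.action_closed h by auto
      show "b (inv\<^bsub>G\<^esub> h) (b h z) = z" if "z \<in> K" for z using act.action_inv[OF h that] .
      show "b h (b (inv\<^bsub>G\<^esub> h) z) = z" if "z \<in> K" for z
        using act.action_inv[OF inv_closed[OF h] that] h by simp
    qed
  next
    case (eng h1 h2)
    have "h1 \<in> carrier G" "h2 \<in> carrier G"
      using eng.hyps generate_in_carrier[OF gs] by auto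
    then show ?case
      by (intro eff_map_cong[OF eff_map_compose[OF eng.IH]]) (simp add: act.composition_rule)
  qed
qed

text \<open>
  Words over the generators and their inverses are lists of pairs of naturals, the second component
  being \<open>0\<close> for an inverse and \<open>1\<close> otherwise.
\<close>

type_synonym nword = "(nat \<times> nat) list"

definition nat_word :: "word \<Rightarrow> nword" where
  "nat_word w = map (\<lambda>(i, \<beta>). (i, of_bool \<beta>)) w"

definition letter_value :: "('g, 'b) monoid_scheme \<Rightarrow> 'g list \<Rightarrow> nat \<times> nat \<Rightarrow> 'g" where
  "letter_value G gs l = (if snd l \<noteq> 0 then gs ! fst l else inv\<^bsub>G\<^esub> (gs ! fst l))"

definition word_value :: "('g, 'b) monoid_scheme \<Rightarrow> 'g list \<Rightarrow> nword \<Rightarrow> 'g" where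
  "word_value G gs w = foldr (\<lambda>l h. letter_value G gs l \<otimes>\<^bsub>G\<^esub> h) w \<one>\<^bsub>G\<^esub>"

definition nword_letters :: "nat \<Rightarrow> nword \<Rightarrow> bool" where
  "nword_letters N w \<longleftrightarrow> (\<forall>l\<in>set w. fst l < N)"

text \<open>Bounded quantifiers, \<open>entry\<close> and negated equations are chosen to match
  \<open>decidable_intros\<close>; \<open>nat_word_reduced_iff\<close> provides the link to
  \<open>free_group_words\<close>. The same purpose shapes \<open>npattern\<close> below.\<close>

definition nword_reduced :: "nat \<Rightarrow> nword \<Rightarrow> bool" where
  "nword_reduced N w \<longleftrightarrow> (\<forall>l\<in>set w. fst l < N \<and> snd l \<le> 1) \<and>
     (\<forall>i\<in>set [0..<length w]. \<not> Suc i < length w \<or>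
        \<not> (fst (entry w i) = fst (entry w (Suc i)) \<and> \<not> snd (entry w i) = snd (entry w (Suc i))))"

lemma word_value_nat_word: "word_value G gs (nat_word w) = canonical_epi G gs w"
  unfolding word_value_def canonical_epi_def nat_word_def
  by (induction w) (auto simp: letter_value_def)

lemma enc_nat_word: "enc (nat_word w) = word_encode w"
  by (induction w) (auto simp: nat_word_def word_encode_def)

lemma inj_nat_word: "inj nat_word"
  unfolding nat_word_def by (rule list.inj_map) (auto simp: inj_def)

lemma nat_word_reduced_iff: "nword_reduced N (nat_word w) \<longleftrightarrow> w \<in> free_group_words N"
proof -
  have len: "length (nat_word w) = length w" by (simp add: nat_word_def)
  have entry: "entry (nat_word w) i = (fst (w ! i), of_bool (snd (w ! i)))" if "i < length w" for i
    using that by (simp add: nat_word_def hd_drop_conv_nth split_beta)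
  have 1: "(\<forall>l\<in>set (nat_word w). fst l < N \<and> snd l \<le> 1) \<longleftrightarrow> fst ` set w \<subseteq> {..<N}"
    by (auto simp: nat_word_def)
  have 2: "(\<forall>i\<in>set [0..<length (nat_word w)]. \<not> Suc i < length (nat_word w) \<or>
        \<not> (fst (entry (nat_word w) i) = fst (entry (nat_word w) (Suc i)) \<and>
           \<not> snd (entry (nat_word w) i) = snd (entry (nat_word w) (Suc i))))
     \<longleftrightarrow> successively (\<lambda>(i, b) (j, c). \<not> (i = j \<and> b \<noteq> c)) w"
    unfolding successively_conv_nth len by (auto simp: entry split_beta)
  show ?thesis
    unfolding nword_reduced_def 1 2 by (simp add: free_group_words_def)
qed

lemma nword_reduced_nat_word:
  assumes "nword_reduced N w"
  shows "\<exists>v. w = nat_word v"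
proof
  have "(fst l, of_bool (snd l \<noteq> 0)) = l" if "l \<in> set w" for l
    using assms that by (cases l) (force simp: nword_reduced_def)
  then show "w = nat_word (map (\<lambda>l. (fst l, snd l \<noteq> 0)) w)"
    unfolding nat_word_def by (simp add: comp_def map_idI)
qed

lemma nword_reduced_letters: "nword_reduced N w \<Longrightarrow> nword_letters N w"
  by (simp add: nword_reduced_def nword_letters_def)

lemma decidable_nword_reduced:
  assumes "crec w"
  shows "decidable (\<lambda>x. nword_reduced N (w x))"
  unfolding nword_reduced_def
  by (intro decidable_intros crec_intros crec_comp[OF assms] assms)

definition npattern :: "nat \<Rightarrow> nat \<Rightarrow> (nword \<times> nat) list \<Rightarrow> bool" where
  "npattern N n l \<longleftrightarrow>
     (\<forall>i\<in>set [0..<length l]. \<forall>j\<in>set [0..<length l]. i = j \<or> \<not> fst (entry l i) = fst (entry l j)) \<and>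
     (\<forall>p\<in>set l. nword_reduced N (fst p) \<and> snd p < n)"

lemma npattern_iff:
  "npattern N n l \<longleftrightarrow> distinct (map fst l) \<and> (\<forall>p\<in>set l. nword_reduced N (fst p) \<and> snd p < n)"
  unfolding npattern_def distinct_conv_nth by (fastforce simp: hd_drop_conv_nth)

lemma decidable_npattern: "decidable (npattern N n)"
  unfolding npattern_def
  by (intro decidable_intros decidable_nword_reduced crec_intros)

section \<open>Values of words and the word problem\<close>

context group
begin

lemma letter_value_closed:
  "set gs \<subseteq> carrier G \<Longrightarrow> fst l < length gs \<Longrightarrow> letter_value G gs l \<in> carrier G"
  unfolding letter_value_def using nth_mem by (auto intro!: inv_closed)

lemma word_value_Nil [simp]: "word_value G gs [] = \<one>"
  by (simp add: word_value_def)

lemma word_value_Cons [simp]: "word_value G gs (l # w) = letter_value G gs l \<otimes> word_value G gs w"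
  by (simp add: word_value_def)

lemma nword_letters_Cons [simp]: "nword_letters N (l # w) \<longleftrightarrow> fst l < N \<and> nword_letters N w"
  by (auto simp: nword_letters_def)

lemma word_value_closed:
  "set gs \<subseteq> carrier G \<Longrightarrow> nword_letters (length gs) w \<Longrightarrow> word_value G gs w \<in> carrier G"
  by (induction w) (auto simp: letter_value_closed)

text \<open>Two words agree iff the inverse of the first times the second is trivial. The hypothesis
  concerns words without signs, so an inverse letter is replaced by the index of a list member with
  the same value, which exists by symmetry. A finite table makes this replacement recursive.\<close>

lemma semidec_word_problem:
  assumes gens: "set gs \<subseteq> carrier G" and sym: "\<forall>g\<in>set gs. inv g \<in> set gs"
    and re: "re_set {list_encode w | w. set w \<subseteq> {..<length gs} \<and> monoid_word_value G gs w = \<one>}"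
  shows "\<exists>W. semidec (\<lambda>p. W (fst p) (snd p)) \<and>
     (\<forall>u v. nword_letters (length gs) u \<longrightarrow> nword_letters (length gs) v \<longrightarrow>
       (W u v \<longleftrightarrow> word_value G gs u = word_value G gs v))"
proof -
  obtain f where f: "{list_encode w | w. set w \<subseteq> {..<length gs} \<and> monoid_word_value G gs w = \<one>} = enumerated f []"
    using re by (auto simp: re_set_def)
  have "\<forall>i<length gs. \<exists>j<length gs. gs ! j = inv (gs ! i)"
    using sym by (metis in_set_conv_nth nth_mem)
  then obtain \<sigma> where \<sigma>: "\<And>i. i < length gs \<Longrightarrow> \<sigma> i < length gs \<and> gs ! \<sigma> i = inv (gs ! i)" by metis
  define \<tau> where "\<tau> = (\<lambda>l :: nat \<times> nat. if snd l = 0 then entry (map \<sigma> [0..<length gs]) (fst l) else fst l)"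
  have \<tau>: "\<tau> l < length gs \<and> gs ! \<tau> l = letter_value G gs l" if "fst l < length gs" for l
    using that \<sigma>[OF that] by (auto simp: \<tau>_def letter_value_def hd_drop_conv_nth)
  define flip where "flip = (\<lambda>l :: nat \<times> nat. (fst l, if snd l = 0 then 1 else 0 :: nat))"
  have flip: "letter_value G gs (flip l) = inv (letter_value G gs l)" if "fst l < length gs" for l
    using subsetD[OF gens nth_mem[OF that]] by (simp add: flip_def letter_value_def)
  have crec: "crec \<tau>" "crec flip"
    unfolding \<tau>_def flip_def by (intro crec_if decidable_eq crec_intros)+
  define W where "W = (\<lambda>u v. enc (map \<tau> (rev (map flip u) @ v)) \<in> enumerated f [])"
  have "semidec (\<lambda>p. W (fst p) (snd p))"
    unfolding W_def by (intro semidec_enumerated crec_intros crec_map crec)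
  moreover have "W u v \<longleftrightarrow> word_value G gs u = word_value G gs v"
    if u: "nword_letters (length gs) u" and v: "nword_letters (length gs) v" for u v
  proof -
    have map_\<tau>: "set (map \<tau> w) \<subseteq> {..<length gs} \<and> monoid_word_value G gs (map \<tau> w) = word_value G gs w"
      if "nword_letters (length gs) w" for w
      using that by (induction w) (auto simp: monoid_word_value_def \<tau>)
    have append: "nword_letters (length gs) (w @ w') \<and> word_value G gs (w @ w') = word_value G gs w \<otimes> word_value G gs w'"
      if "nword_letters (length gs) w" "nword_letters (length gs) w'" for w w'
      using that by (induction w) (auto simp: m_assoc letter_value_closed[OF gens] word_value_closed[OF gens])
    have inverse: "nword_letters (length gs) (rev (map flip w)) \<and> word_value G gs (rev (map flip w)) = inv (word_value G gs w)"
      if "nword_letters (length gs) w" for w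
      using that
    proof (induction w)
      case (Cons l w)
      have "nword_letters (length gs) [flip l]"
        using Cons.prems by (simp add: nword_letters_def flip_def)
      then show ?case
        using Cons append[of "rev (map flip w)" "[flip l]"]
        by (simp add: flip inv_mult_group letter_value_closed[OF gens] word_value_closed[OF gens])
    qed simp
    let ?w = "rev (map flip u) @ v"
    have w: "nword_letters (length gs) ?w" "word_value G gs ?w = inv (word_value G gs u) \<otimes> word_value G gs v"
      using append[of "rev (map flip u)" v] inverse[OF u] v by auto
    have "W u v \<longleftrightarrow> set (map \<tau> ?w) \<subseteq> {..<length gs} \<and> monoid_word_value G gs (map \<tau> ?w) = \<one>"
      unfolding W_def f[symmetric] enc_nat_list by (auto simp: list_encode_eq)
    also have "\<dots> \<longleftrightarrow> inv (word_value G gs u) \<otimes> word_value G gs v = \<one>"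
      using map_\<tau>[OF w(1)] w(2) by simp
    also have "\<dots> \<longleftrightarrow> word_value G gs u = word_value G gs v"
      using word_value_closed[OF gens u] word_value_closed[OF gens v]
      by (metis inv_closed inv_equality inv_inv l_inv)
    finally show ?thesis .
  qed
  ultimately show ?thesis by blast
qed

end

section \<open>Deciding which patterns the coding excludes\<close>

locale effective_coding = rec_compact_set M d s K + closed_coding G "subtopology (Metric_space.mtopology M d) K" b n C
  for M :: "'m set" and d s K and G (structure) and b n C +
  fixes gs :: "'a list" and J :: "nat \<Rightarrow> nat list"
  assumes gens: "generating_list G gs"
    and eff: "g \<in> carrier G \<Longrightarrow> eff_map (b g)"
    and members: "i < n \<Longrightarrow> C i = K - balls (set (J i))"
begin

interpretation act: group_action G K b
  using action by (simp only: topspace_KT)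

abbreviation "N \<equiv> length gs"
abbreviation "val \<equiv> word_value G gs"

lemma gs_subset: "set gs \<subseteq> carrier G"
  using gens by (simp add: generating_list_def)

text \<open>Finitely many unrelated algorithms, one for each letter, are merged into a single one
  that takes the letter as input.\<close>

lemma ex_step:
  "\<exists>Step. semidec (\<lambda>p. Step (fst p) (fst (snd p)) (snd (snd p))) \<and>
     (\<forall>l m z. fst l < N \<longrightarrow> z \<in> K \<longrightarrow>
       (b (inv (letter_value G gs l)) z \<in> bball m \<longleftrightarrow> (\<exists>k. Step l m k \<and> z \<in> bball k)))"
proof -
  have "\<forall>g\<in>carrier G. \<exists>S. semidec (\<lambda>p. S (fst p) (snd p)) \<and>
      (\<forall>m. {z \<in> K. b (inv g) z \<in> bball m} = balls {k. S m k} \<inter> K)"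
    using eff inv_closed unfolding eff_map_def by meson
  then obtain S where S: "\<And>g. g \<in> carrier G \<Longrightarrow> semidec (\<lambda>p. S g (fst p) (snd p))"
    "\<And>g m. g \<in> carrier G \<Longrightarrow> {z \<in> K. b (inv g) z \<in> bball m} = balls {k. S g m k} \<inter> K"
    unfolding bchoice_iff by blast
  \<comment> \<open>\<open>min 1\<close> normalises the sign: \<open>letter_value\<close> treats
    every nonzero second component alike.\<close>
  define Step where "Step = (\<lambda>l m k. \<exists>i\<in>{..<N}. \<exists>\<beta>\<in>{0, 1}. fst l = i \<and> min 1 (snd l) = \<beta> \<and> S (letter_value G gs (i, \<beta>)) m k)"
  have letter: "letter_value G gs l = letter_value G gs (fst l, min 1 (snd l))" for l
    by (auto simp: letter_value_def)
  have min: "min 1 u = (\<beta> :: nat) \<longleftrightarrow> (\<beta> = 0 \<and> u = 0) \<or> (\<beta> = 1 \<and> 1 \<le> u)" if "\<beta> \<in> {0, 1}" for u \<beta>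
    using that by auto
  have "semidec (\<lambda>p. Step (fst p) (fst (snd p)) (snd (snd p)))"
    unfolding Step_def
  proof (intro semidec_finite_Bex)
    fix i \<beta> :: nat assume i\<beta>: "i \<in> {..<N}" "\<beta> \<in> {0, 1}"
    then have "letter_value G gs (i, \<beta>) \<in> carrier G"
      using letter_value_closed[OF gs_subset] by simp
    from semidec_comp[OF S(1)[OF this], of "\<lambda>p :: (nat \<times> nat) \<times> nat \<times> nat. (fst (snd p), snd (snd p))"]
    have *: "semidec (\<lambda>p :: (nat \<times> nat) \<times> nat \<times> nat. S (letter_value G gs (i, \<beta>)) (fst (snd p)) (snd (snd p)))"
      by (simp add: crec_intros)
    show "semidec (\<lambda>p. fst (fst p) = i \<and> min 1 (snd (fst p)) = \<beta> \<and> S (letter_value G gs (i, \<beta>)) (fst (snd p)) (snd (snd p)))"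
      unfolding min[OF i\<beta>(2)]
      by (intro semidec_conj * semidec_decidable decidable_intros crec_intros)
  qed simp_all
  moreover have "b (inv (letter_value G gs l)) z \<in> bball m \<longleftrightarrow> (\<exists>k. Step l m k \<and> z \<in> bball k)"
    if l: "fst l < N" and z: "z \<in> K" for l m z
  proof -
    have "Step l m k \<longleftrightarrow> S (letter_value G gs l) m k" for k
      using l unfolding Step_def letter[of l] by auto
    then show ?thesis
      using S(2)[OF letter_value_closed[OF gs_subset l], of m] z by (auto simp: ball_union_def)
  qed
  ultimately show ?thesis by blast
qed

text \<open>
  The witness is the existence of a chain of balls from \<open>k\<close> to \<open>m\<close>, the part of each ball in \<open>K\<close> being mapped
  into the next one by the inverse of the corresponding letter of \<open>w\<close>.
\<close>

lemma ex_reach: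
  "\<exists>Reach. semidec (\<lambda>p. Reach (fst p) (fst (snd p)) (snd (snd p))) \<and>
     (\<forall>w m z. nword_letters N w \<longrightarrow> z \<in> K \<longrightarrow>
       (b (inv (val w)) z \<in> bball m \<longleftrightarrow> (\<exists>k. Reach w m k \<and> z \<in> bball k)))"
proof -
  obtain Step where Step: "semidec (\<lambda>p. Step (fst p) (fst (snd p)) (snd (snd p)))"
    "\<And>l m z. fst l < N \<Longrightarrow> z \<in> K \<Longrightarrow>
       b (inv (letter_value G gs l)) z \<in> bball m \<longleftrightarrow> (\<exists>k. Step l m k \<and> z \<in> bball k)"
    using ex_step by blast
  define Reach where "Reach = (\<lambda>w m k. \<exists>ks. length ks = Suc (length w) \<and> hd ks = k \<and> entry ks (length w) = m \<and>
      (\<forall>i<length w. Step (entry w i) (entry ks (Suc i)) (entry ks i)))"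
  have Reach_Nil: "Reach [] m k \<longleftrightarrow> k = m" for m k
    unfolding Reach_def by (auto intro!: exI[of _ "[m]"])
  have Reach_Cons: "Reach (l # w) m k \<longleftrightarrow> (\<exists>k'. Step l k' k \<and> Reach w m k')" for l w m k
  proof
    assume "Reach (l # w) m k"
    then obtain ks where ks: "length ks = Suc (Suc (length w))" "hd ks = k" "entry ks (Suc (length w)) = m"
      "\<And>i. i < Suc (length w) \<Longrightarrow> Step (entry (l # w) i) (entry ks (Suc i)) (entry ks i)"
      unfolding Reach_def by auto
    then obtain ks' where ks': "ks = k # ks'" by (cases ks) auto
    have "Step l (hd ks') k" using ks(4)[of 0] by (simp add: ks')
    moreover have "Reach w m (hd ks')"
      unfolding Reach_def using ks(1,3) ks(4)[of "Suc i" for i] by (intro exI[of _ ks']) (auto simp: ks')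
    ultimately show "\<exists>k'. Step l k' k \<and> Reach w m k'" by blast
  next
    assume "\<exists>k'. Step l k' k \<and> Reach w m k'"
    then obtain ks where ks: "Step l (hd ks) k" "length ks = Suc (length w)" "entry ks (length w) = m"
      "\<And>i. i < length w \<Longrightarrow> Step (entry w i) (entry ks (Suc i)) (entry ks i)"
      unfolding Reach_def by auto
    have "Step (entry (l # w) i) (entry (k # ks) (Suc i)) (entry (k # ks) i)" if "i < length (l # w)" for i
      using that ks(1) ks(4)[of "i - 1"] by (cases i) auto
    then show "Reach (l # w) m k"
      unfolding Reach_def using ks by (intro exI[of _ "k # ks"]) auto
  qed
  have step: "semidec (\<lambda>p :: ((nword \<times> nat \<times> nat) \<times> nat list) \<times> nat.
      Step (entry (fst (fst (fst p))) (snd p)) (entry (snd (fst p)) (Suc (snd p))) (entry (snd (fst p)) (snd p)))"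
    using semidec_comp[OF Step(1), of "\<lambda>p :: ((nword \<times> nat \<times> nat) \<times> nat list) \<times> nat.
      (entry (fst (fst (fst p))) (snd p), entry (snd (fst p)) (Suc (snd p)), entry (snd (fst p)) (snd p))"]
    by (simp add: crec_intros)
  have "semidec (\<lambda>p. Reach (fst p) (fst (snd p)) (snd (snd p)))"
    unfolding Reach_def
    by (intro semidec_ex semidec_conj semidec_all_less step semidec_decidable decidable_intros crec_intros)
  moreover have "b (inv (val w)) z \<in> bball m \<longleftrightarrow> (\<exists>k. Reach w m k \<and> z \<in> bball k)"
    if "nword_letters N w" "z \<in> K" for w m z
    using that
  proof (induction w arbitrary: z)
    case Nil
    then show ?case by (simp add: Reach_Nil act.action_one)
  next
    case (Cons l w)
    let ?g = "letter_value G gs l"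
    have g: "?g \<in> carrier G" "val w \<in> carrier G"
      using Cons.prems letter_value_closed word_value_closed gs_subset by auto
    have z': "b (inv ?g) z \<in> K" using act.action_closed[of "inv ?g" z] g Cons.prems by simp
    \<comment> \<open>Inversion reverses the product, so the first letter acts first and the chain
      is read from left to right.\<close>
    have "b (inv (val (l # w))) z = b (inv (val w)) (b (inv ?g) z)"
      using g Cons.prems act.composition_rule[of z "inv (val w)" "inv ?g"] by (simp add: inv_mult_group)
    then have "b (inv (val (l # w))) z \<in> bball m \<longleftrightarrow> (\<exists>k'. Reach w m k' \<and> b (inv ?g) z \<in> bball k')"
      using Cons.IH z' Cons.prems by simp
    also have "\<dots> \<longleftrightarrow> (\<exists>k'. Reach w m k' \<and> (\<exists>k. Step l k' k \<and> z \<in> bball k))"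
      using Step(2)[of l z] Cons.prems by simp
    also have "\<dots> \<longleftrightarrow> (\<exists>k. Reach (l # w) m k \<and> z \<in> bball k)"
      unfolding Reach_Cons by blast
    finally show ?case .
  qed
  ultimately show ?thesis by blast
qed

text \<open>Overlapping members of the cover allow a pattern with two symbols at one group element
  to be realised in this sense. Such patterns are caught by \<open>inconsistent\<close>.\<close>

definition realised :: "(nword \<times> nat) list \<Rightarrow> bool" where
  "realised l \<longleftrightarrow> (\<exists>z\<in>K. \<forall>p\<in>set l. b (inv (val (fst p))) z \<in> C (snd p))"

definition inconsistent :: "(nword \<times> nat) list \<Rightarrow> bool" where
  "inconsistent l \<longleftrightarrow> (\<exists>p\<in>set l. \<exists>q\<in>set l. \<not> snd p = snd q \<and> val (fst p) = val (fst q))"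

lemma ex_semidec_not_realised:
  "\<exists>Bad. semidec Bad \<and> (\<forall>l. npattern N n l \<longrightarrow> (Bad l \<longleftrightarrow> \<not> realised l))"
proof -
  obtain Reach where Reach: "semidec (\<lambda>p. Reach (fst p) (fst (snd p)) (snd (snd p)))"
    "\<And>w m z. nword_letters N w \<Longrightarrow> z \<in> K \<Longrightarrow>
       b (inv (val w)) z \<in> bball m \<longleftrightarrow> (\<exists>k. Reach w m k \<and> z \<in> bball k)"
    using ex_reach by blast
  \<comment> \<open>An arbitrary function \<open>J\<close> need not be recursive. The finite table
    \<open>map J [0..<n]\<close> is recursive and agrees with \<open>J\<close> on the symbols of a
    genuine pattern.\<close>
  define Bad where "Bad = (\<lambda>l :: (nword \<times> nat) list. K \<subseteq> balls {k. \<exists>p\<in>set l.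
      \<exists>m\<in>set (entry (map J [0..<n]) (snd p)). Reach (fst p) m k})"
  have reach: "semidec (\<lambda>q :: (((nword \<times> nat) list \<times> nat) \<times> nword \<times> nat) \<times> nat.
      Reach (fst (snd (fst q))) (snd q) (snd (fst (fst q))))"
    using semidec_comp[OF Reach(1), of "\<lambda>q :: (((nword \<times> nat) list \<times> nat) \<times> nword \<times> nat) \<times> nat.
      (fst (snd (fst q)), snd q, snd (fst (fst q)))"] by (simp add: crec_intros)
  have "semidec Bad"
    unfolding Bad_def by (intro semidec_cover semidec_bex reach crec_intros)
  moreover have "Bad l \<longleftrightarrow> \<not> realised l" if l: "npattern N n l" for l
  proof -
    have "z \<in> balls {k. \<exists>p\<in>set l. \<exists>m\<in>set (entry (map J [0..<n]) (snd p)). Reach (fst p) m k} \<longleftrightarrow>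
        (\<exists>p\<in>set l. b (inv (val (fst p))) z \<notin> C (snd p))" if z: "z \<in> K" for z
    proof -
      have *: "(\<exists>m\<in>set (entry (map J [0..<n]) (snd p)). \<exists>k. Reach (fst p) m k \<and> z \<in> bball k)
          \<longleftrightarrow> b (inv (val (fst p))) z \<notin> C (snd p)" if p: "p \<in> set l" for p
      proof -
        have w: "nword_letters N (fst p)" and c: "snd p < n"
          using l p by (auto simp: npattern_iff nword_reduced_letters)
        have "inv (val (fst p)) \<in> carrier G"
          using word_value_closed[OF gs_subset w] by simp
        then have "b (inv (val (fst p))) z \<in> K" using z by (rule act.action_closed)
        then show ?thesis
          using c by (simp add: members hd_drop_conv_nth Reach(2)[OF w z, symmetric] ball_union_def)
      qed
      have "z \<in> balls {k. \<exists>p\<in>set l. \<exists>m\<in>set (entry (map J [0..<n]) (snd p)). Reach (fst p) m k} \<longleftrightarrow>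
          (\<exists>p\<in>set l. \<exists>m\<in>set (entry (map J [0..<n]) (snd p)). \<exists>k. Reach (fst p) m k \<and> z \<in> bball k)"
        by (auto simp only: ball_union_def UN_iff mem_Collect_eq)
      then show ?thesis using * by simp
    qed
    then show ?thesis unfolding Bad_def realised_def by blast
  qed
  ultimately show ?thesis by blast
qed

text \<open>For a fixed point \<open>z\<close>, the conditions in \<open>codes\<close> at different
  group elements are independent. Any coding of \<open>z\<close> can thus be overwritten at the
  values of the listed words, and consistency makes the new symbols well defined.\<close>

lemma configuration_iff:
  assumes l: "npattern N n l"
  shows "(\<exists>x\<in>coding_shift. \<forall>p\<in>set l. x (val (fst p)) = snd p) \<longleftrightarrow> realised l \<and> \<not> inconsistent l"
proof
  assume "\<exists>x\<in>coding_shift. \<forall>p\<in>set l. x (val (fst p)) = snd p"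
  then obtain x z where x: "codes x z" "\<And>p. p \<in> set l \<Longrightarrow> x (val (fst p)) = snd p"
    by (auto simp: coding_shift_def)
  have "val (fst p) \<in> carrier G" if "p \<in> set l" for p
    using l that by (auto simp: npattern_iff nword_reduced_letters word_value_closed[OF gs_subset])
  then have "\<forall>p\<in>set l. b (inv (val (fst p))) z \<in> C (snd p)"
    using x unfolding codes_def by metis
  moreover have "z \<in> K" using x(1) unfolding codes_def topspace_KT by blast
  moreover have "\<not> inconsistent l"
    using x(2) unfolding inconsistent_def by metis
  ultimately show "realised l \<and> \<not> inconsistent l"
    unfolding realised_def by blast
next
  assume R: "realised l \<and> \<not> inconsistent l"
  then obtain z where z: "z \<in> K" "\<And>p. p \<in> set l \<Longrightarrow> b (inv (val (fst p))) z \<in> C (snd p)"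
    by (auto simp: realised_def)
  have z': "z \<in> topspace KT" unfolding topspace_KT by (rule z)
  obtain x where x: "codes x z" by (rule ex_codes[OF z'])
  define x' where "x' = (\<lambda>g. if \<exists>p\<in>set l. val (fst p) = g then snd (SOME p. p \<in> set l \<and> val (fst p) = g) else x g)"
  have x'_l: "x' (val (fst p)) = snd p" if p: "p \<in> set l" for p
  proof -
    have "(SOME q. q \<in> set l \<and> val (fst q) = val (fst p)) \<in> set l \<and>
        val (fst (SOME q. q \<in> set l \<and> val (fst q) = val (fst p))) = val (fst p)"
      by (rule someI[of _ p]) (use p in simp)
    then have "snd (SOME q. q \<in> set l \<and> val (fst q) = val (fst p)) = snd p"
      using R p unfolding inconsistent_def by blast
    then show ?thesis using p by (auto simp: x'_def)
  qed
  have "codes x' z"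
    unfolding codes_def
  proof (intro conjI ballI z' PiE_I)
    fix g assume g: "g \<in> carrier G"
    show "x' g \<in> {..<n}"
    proof (cases "\<exists>p\<in>set l. val (fst p) = g")
      case True
      then show ?thesis using x'_l l by (auto simp: npattern_iff)
    next
      case False
      then show ?thesis using x g by (auto simp: x'_def codes_def)
    qed
    show "b (inv g) z \<in> C (x' g)"
    proof (cases "\<exists>p\<in>set l. val (fst p) = g")
      case True
      then show ?thesis using x'_l z by auto
    next
      case False
      then show ?thesis using x g by (simp add: x'_def codes_def)
    qed
  next
    fix g assume g: "g \<notin> carrier G"
    have "\<not> (\<exists>p\<in>set l. val (fst p) = g)"
      using g l by (auto simp: npattern_iff nword_reduced_letters word_value_closed[OF gs_subset])
    then show "x' g = undefined" using x g by (auto simp: x'_def codes_def)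
  qed
  then show "\<exists>x\<in>coding_shift. \<forall>p\<in>set l. x (val (fst p)) = snd p"
    using x'_l by (auto simp: coding_shift_def)
qed

text \<open>Replacing the Boolean signs by 0 and 1 preserves codes number for number, and every list
  accepted by \<open>npattern\<close> arises in this way. Recursive enumerability can therefore be
  established on coded lists.\<close>

lemma excluded_pattern_codes:
  "pattern_codes (excluded_patterns N {..<n} (pullback G gs coding_shift)) =
     {enc l | l. npattern N n l \<and> (\<not> realised l \<or> inconsistent l)}"
proof -
  define lift where "lift = map (\<lambda>(w, c :: nat). (nat_word w, c))"
  have enc_lift: "enc (lift l) = list_encode (map (\<lambda>(w, c). prod_encode (word_encode w, c)) l)" for l
    by (induction l) (auto simp: lift_def enc_nat_word)
  have lift: "distinct (map fst l) \<and> map_of l \<in> excluded_patterns N {..<n} (pullback G gs coding_shift)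
      \<longleftrightarrow> npattern N n (lift l) \<and> (\<not> realised (lift l) \<or> inconsistent (lift l))" for l
  proof -
    have "map fst (lift l) = map nat_word (map fst l)"
      by (auto simp: lift_def)
    then have dist: "distinct (map fst (lift l)) \<longleftrightarrow> distinct (map fst l)"
      using inj_nat_word by (metis distinct_map inj_on_subset subset_UNIV)
    have np: "npattern N n (lift l) \<longleftrightarrow> distinct (map fst l) \<and> (\<forall>(w, c)\<in>set l. w \<in> free_group_words N \<and> c < n)"
      unfolding npattern_iff dist by (auto simp: lift_def nat_word_reduced_iff)
    have "map_of l \<in> excluded_patterns N {..<n} (pullback G gs coding_shift) \<longleftrightarrow>
        (\<forall>(w, c)\<in>set l. w \<in> free_group_words N \<and> c < n) \<and>
        \<not> (\<exists>x\<in>coding_shift. \<forall>p\<in>set (lift l). x (val (fst p)) = snd p)"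
      if d: "distinct (map fst l)"
    proof -
      have pat: "map_of l \<in> patterns N {..<n} \<longleftrightarrow> (\<forall>(w, c)\<in>set l. w \<in> free_group_words N \<and> c < n)"
        unfolding patterns_def by (auto simp: finite_dom_map_of dom_map_of_conv_image_fst ran_distinct[OF d])
      have "(\<exists>y\<in>pullback G gs coding_shift. \<forall>w\<in>dom (map_of l). map_of l w = Some (y w)) \<longleftrightarrow>
          (\<exists>x\<in>coding_shift. \<forall>p\<in>set (lift l). x (val (fst p)) = snd p)"
        if words: "\<forall>(w, c)\<in>set l. w \<in> free_group_words N \<and> c < n"
      proof -
        have "(\<forall>w\<in>dom (map_of l). map_of l w = Some (restrict (x \<circ> canonical_epi G gs) (free_group_words N) w)) \<longleftrightarrow>
            (\<forall>p\<in>set (lift l). x (val (fst p)) = snd p)" for x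
        proof -
          have "(\<forall>w\<in>dom (map_of l). map_of l w = Some (restrict (x \<circ> canonical_epi G gs) (free_group_words N) w)) \<longleftrightarrow>
              (\<forall>(w, c)\<in>set l. c = restrict (x \<circ> canonical_epi G gs) (free_group_words N) w)"
            unfolding dom_map_of_conv_image_fst using map_of_is_SomeI[OF d] by fastforce
          also have "\<dots> \<longleftrightarrow> (\<forall>(w, c)\<in>set l. c = x (val (nat_word w)))"
            using words by (intro ball_cong refl) (auto simp: word_value_nat_word)
          also have "\<dots> \<longleftrightarrow> (\<forall>p\<in>set (lift l). x (val (fst p)) = snd p)"
            by (auto simp: lift_def)
          finally show ?thesis .
        qed
        then show ?thesis by (simp only: pullback_def bex_simps)
      qed
      then show ?thesis unfolding excluded_patterns_def using pat by blast
    qed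
    then show ?thesis
      using np configuration_iff[of "lift l"] by blast
  qed
  have surj: "\<exists>l'. l = lift l'" if "npattern N n l" for l
  proof -
    have "\<forall>p\<in>set l. \<exists>w. fst p = nat_word w"
      using that nword_reduced_nat_word by (auto simp: npattern_iff)
    then obtain f where f: "\<And>p. p \<in> set l \<Longrightarrow> fst p = nat_word (f p)" by metis
    have "l = lift (map (\<lambda>p. (f p, snd p)) l)"
      unfolding lift_def using f by (simp add: comp_def) (rule map_idI[symmetric], metis prod.collapse)
    then show ?thesis by blast
  qed
  show ?thesis
    unfolding pattern_codes_def enc_lift[symmetric] lift using surj by blast
qed

text \<open>\<open>Excl\<close> may answer arbitrarily on lists that are no patterns, because it is
  conjoined with the decidable \<open>npattern\<close>.\<close>

lemma effective_subshift_coding_shift: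
  assumes "semidec Excl" "\<And>l. npattern N n l \<Longrightarrow> Excl l \<longleftrightarrow> \<not> realised l \<or> inconsistent l"
  shows "effective_subshift G {..<n} coding_shift"
proof -
  have "{enc l | l. npattern N n l \<and> (\<not> realised l \<or> inconsistent l)} = {enc l | l. npattern N n l \<and> Excl l}"
    using assms(2) by blast
  moreover have "re_set {enc l | l. npattern N n l \<and> Excl l}"
    by (intro re_set_semidec semidec_conj semidec_decidable decidable_npattern assms(1))
  ultimately show ?thesis
    unfolding effective_subshift_def effectively_closed_def excluded_pattern_codes
    using gens subshift_coding_shift excluded_pattern_codes by auto
qed

lemma effective_coding_shift_disjoint:
  assumes disjoint: "\<And>i j. i < n \<Longrightarrow> j < n \<Longrightarrow> i \<noteq> j \<Longrightarrow> C i \<inter> C j = {}"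
  shows "effective_subshift G {..<n} coding_shift"
proof -
  obtain Bad where Bad: "semidec Bad" "\<And>l. npattern N n l \<Longrightarrow> Bad l \<longleftrightarrow> \<not> realised l"
    using ex_semidec_not_realised by blast
  \<comment> \<open>Two symbols at one group element would place one point in two disjoint
    members.\<close>
  have "\<not> realised l" if "npattern N n l" "inconsistent l" for l
  proof
    assume "realised l"
    with that(2) obtain z p q where "p \<in> set l" "q \<in> set l" "snd p \<noteq> snd q"
      "b (inv (val (fst p))) z \<in> C (snd p)" "b (inv (val (fst p))) z \<in> C (snd q)"
      unfolding realised_def inconsistent_def by metis
    moreover from this have "snd p < n" "snd q < n"
      using that(1) by (auto simp: npattern_iff)
    ultimately show False using disjoint by blast
  qed
  then show ?thesis
    using effective_subshift_coding_shift[OF Bad(1)] Bad(2) by blast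
qed

lemma effective_coding_shift_recursively_presented:
  assumes sym: "\<forall>g\<in>set gs. inv g \<in> set gs"
    and re: "re_set {list_encode w | w. set w \<subseteq> {..<length gs} \<and> monoid_word_value G gs w = \<one>}"
  shows "effective_subshift G {..<n} coding_shift"
proof -
  obtain Bad where Bad: "semidec Bad" "\<And>l. npattern N n l \<Longrightarrow> Bad l \<longleftrightarrow> \<not> realised l"
    using ex_semidec_not_realised by blast
  obtain W :: "nword \<Rightarrow> nword \<Rightarrow> bool" where W: "semidec (\<lambda>p. W (fst p) (snd p))"
    "\<And>u v. nword_letters N u \<Longrightarrow> nword_letters N v \<Longrightarrow> W u v \<longleftrightarrow> val u = val v"
    using semidec_word_problem[OF gs_subset sym re] by blast
  define Inc where "Inc = (\<lambda>l :: (nword \<times> nat) list. \<exists>p\<in>set l. \<exists>q\<in>set l. \<not> snd p = snd q \<and> W (fst p) (fst q))"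
  have w: "semidec (\<lambda>r :: ((nword \<times> nat) list \<times> nword \<times> nat) \<times> nword \<times> nat. W (fst (snd (fst r))) (fst (snd r)))"
    using semidec_comp[OF W(1), of "\<lambda>r :: ((nword \<times> nat) list \<times> nword \<times> nat) \<times> nword \<times> nat. (fst (snd (fst r)), fst (snd r))"]
    by (simp add: crec_intros)
  have "semidec Inc"
    unfolding Inc_def by (intro semidec_bex semidec_conj w semidec_decidable decidable_intros crec_intros)
  then have "semidec (\<lambda>l. Bad l \<or> Inc l)"
    by (intro semidec_disj Bad)
  moreover have "Inc l \<longleftrightarrow> inconsistent l" if "npattern N n l" for l
    unfolding Inc_def inconsistent_def using that
    by (intro bex_cong refl) (auto simp: W npattern_iff nword_reduced_letters)
  ultimately show ?thesis
    using effective_subshift_coding_shift Bad(2) by blast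
qed

end


section \<open>Closed covers with effectively open complements\<close>

text \<open>Choosing a shared member at each \<open>g\<close> in \<open>F\<close> puts both points
  into one element of the join. For distinct points the diameter of the join can be brought down to
  half their distance, a contradiction.\<close>

lemma generating_cover_separates:
  assumes gen: "generating_cover G X a P" and xy: "x \<in> topspace X" "y \<in> topspace X"
    and same: "\<And>g. g \<in> carrier G \<Longrightarrow> \<exists>U\<in>P. a g x \<in> U \<and> a g y \<in> U"
  shows "x = y"
proof (rule ccontr)
  assume "x \<noteq> y"
  obtain d where d: "Metric_space (topspace X) d"
    "\<And>\<epsilon>. \<epsilon> > 0 \<Longrightarrow> \<exists>F. finite F \<and> F \<subseteq> carrier G \<and> cover_diam_le d (translated_join X a P F) \<epsilon>"
    using gen unfolding generating_cover_def by blast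
  interpret Metric_space "topspace X" d by (rule d)
  have pos: "0 < d x y / 2" using \<open>x \<noteq> y\<close> xy mdist_pos_eq by simp
  obtain F where F: "F \<subseteq> carrier G" "cover_diam_le d (translated_join X a P F) (d x y / 2)"
    using d(2)[OF pos] by blast
  have "\<forall>g\<in>F. \<exists>U\<in>P. a g x \<in> U \<and> a g y \<in> U" using same F by blast
  then obtain c where c: "\<And>g. g \<in> F \<Longrightarrow> c g \<in> P \<and> a g x \<in> c g \<and> a g y \<in> c g" by metis
  let ?A = "{x \<in> topspace X. \<forall>g\<in>F. a g x \<in> c g}"
  have A: "?A \<in> translated_join X a P F"
    unfolding translated_join_def using c by blast
  have "x \<in> ?A" "y \<in> ?A" using c xy by auto
  then have "d x y \<le> d x y / 2"
    by (rule F(2)[unfolded cover_diam_le_def, rule_format, OF A])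
  then show False using pos by simp
qed

lemma zero_dimensional_disjoint_refinement:
  assumes "zero_dimensional X" "is_open_cover X P"
  obtains Q where "is_open_cover X Q" "\<And>V. V \<in> Q \<Longrightarrow> \<exists>U\<in>P. V \<subseteq> U" "disjoint Q"
proof -
  obtain Q where Q: "is_open_cover X Q" "\<forall>V\<in>Q. \<exists>U\<in>P. V \<subseteq> U"
    "\<forall>x\<in>topspace X. card {V \<in> Q. x \<in> V} \<le> 0 + 1"
    using assms unfolding zero_dimensional_def covering_dim_le_def by blast
  have fin: "finite Q" using Q(1) by (simp add: is_open_cover_def)
  have "V \<inter> V' = {}" if V: "V \<in> Q" "V' \<in> Q" "V \<noteq> V'" for V V'
  proof (rule ccontr)
    assume "V \<inter> V' \<noteq> {}"
    then obtain x where x: "x \<in> V" "x \<in> V'" by blast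
    then have "x \<in> topspace X" using Q(1) V by (auto simp: is_open_cover_def)
    then have "card {V \<in> Q. x \<in> V} \<le> 1" using Q(3) by auto
    moreover have "card {V, V'} \<le> card {V \<in> Q. x \<in> V}"
      using V x fin by (intro card_mono) auto
    ultimately show False using V(3) by simp
  qed
  then have "disjoint Q" by (rule disjointI)
  then show ?thesis using that Q by blast
qed

lemma is_open_cover_homeomorphic_image:
  assumes "is_open_cover X Q" "homeomorphic_map X Y \<pi>"
  shows "is_open_cover Y ((`) \<pi> ` Q)"
  unfolding is_open_cover_def
proof (intro conjI ballI)
  show "finite ((`) \<pi> ` Q)" using assms(1) by (simp add: is_open_cover_def)
  show "openin Y V" if "V \<in> (`) \<pi> ` Q" for V
    using that assms(1) homeomorphic_imp_open_map[OF assms(2)]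
    by (auto simp: is_open_cover_def open_map_def)
  have "\<Union>((`) \<pi> ` Q) = \<pi> ` \<Union>Q" by blast
  then show "\<Union>((`) \<pi> ` Q) = topspace Y"
    using assms(1) homeomorphic_imp_surjective_map[OF assms(2)] by (simp add: is_open_cover_def)
qed

context rec_compact_set
begin

lemma closedin_complement_balls: "closedin KT (K - balls I)"
proof -
  have "openin KT (K \<inter> balls I)"
    using openin_balls by (auto simp: openin_subtopology)
  then have "closedin KT (topspace KT - K \<inter> balls I)"
    by (rule closedin_diff[OF closedin_topspace])
  then show ?thesis unfolding topspace_KT by (simp add: Diff_Int)
qed

lemma compactin_complement_open:
  assumes "openin KT U"
  shows "compactin mtopology (K - U)"
proof -
  have "closedin KT (K - U)"
    using assms by (metis closedin_diff closedin_topspace topspace_KT)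
  then have "compactin KT (K - U)"
    by (intro closedin_compact_space) (simp add: compact_space_subtopology compactin_K)
  then show ?thesis by (simp add: compactin_subtopology)
qed

text \<open>
  Balls of radius less than half a Lebesgue number around the complement of a member of the cover:
  what they leave uncovered still covers \<open>K\<close>.
\<close>

lemma closed_shrinking:
  assumes P: "is_open_cover KT P"
  shows "\<exists>(n::nat) J. (\<forall>i<n. \<exists>U\<in>P. K - balls (set (J i)) \<subseteq> U) \<and>
    K = (\<Union>i<n. K - balls (set (J i)))"
proof -
  have fin: "finite P" and op: "\<And>U. U \<in> P \<Longrightarrow> openin KT U" and un: "\<Union>P = K"
    using P unfolding is_open_cover_def topspace_KT by auto
  obtain Us where Us: "set Us = P" using finite_list[OF fin] by blast
  \<comment> \<open>The Lebesgue number is taken for sets open in the ambient space, hence the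
    extensions \<open>W U\<close>.\<close>
  have "\<forall>U\<in>P. \<exists>W. openin mtopology W \<and> U = W \<inter> K"
    using op by (simp add: openin_subtopology)
  then obtain W where W: "\<And>U. U \<in> P \<Longrightarrow> openin mtopology (W U)" "\<And>U. U \<in> P \<Longrightarrow> U = W U \<inter> K"
    by metis
  have "K \<subseteq> \<Union>(W ` P)" using un W(2) by blast
  then obtain \<epsilon> where \<epsilon>: "\<epsilon> > 0" "\<And>x. x \<in> K \<Longrightarrow> \<exists>V\<in>W ` P. mball x \<epsilon> \<subseteq> V"
    using lebesgue_number[OF compactin_K, of "W ` P"] W(1) by blast
  define I where "I = (\<lambda>i. {k. \<exists>j q y. k = prod_encode (j, q) \<and> posrat_of_code q < \<epsilon> / 2 \<and>
      y \<in> K - Us ! i \<and> d (s j) y < posrat_of_code q})"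
  have "\<exists>ks. set ks \<subseteq> I i \<and> K - Us ! i \<subseteq> balls (set ks)" if i: "i < length Us" for i
  proof -
    have cov: "K - Us ! i \<subseteq> balls (I i)"
    proof
      fix y assume y: "y \<in> K - Us ! i"
      then have yM: "y \<in> M" using K_subset by blast
      obtain j q where "posrat_of_code q < \<epsilon> / 2" "d (s j) y < posrat_of_code q"
        using ex_small_ball[OF yM half_gt_zero[OF \<epsilon>(1)]] by blast
      then have "prod_encode (j, q) \<in> I i" "y \<in> bball (prod_encode (j, q))"
        using y yM by (auto simp: I_def in_bball)
      then show "y \<in> balls (I i)" by (auto simp: ball_union_def)
    qed
    have "Us ! i \<in> P" using Us i nth_mem by blast
    then have "compactin mtopology (K - Us ! i)"
      by (intro compactin_complement_open op)
    then obtain ks where "set ks \<subseteq> I i" "K - Us ! i \<subseteq> balls (set ks)"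
      by (rule finite_ball_cover[OF _ cov])
    then show ?thesis by (intro exI conjI)
  qed
  then obtain J where J: "\<And>i. i < length Us \<Longrightarrow> set (J i) \<subseteq> I i \<and> K - Us ! i \<subseteq> balls (set (J i))"
    by metis
  show ?thesis
  proof (intro exI conjI allI impI)
    fix i assume "i < length Us"
    then show "\<exists>U\<in>P. K - balls (set (J i)) \<subseteq> U"
      using J Us nth_mem by blast
  next
    have "\<exists>i<length Us. x \<notin> balls (set (J i))" if x: "x \<in> K" for x
    proof -
      \<comment> \<open>The member that keeps \<open>x\<close> is one whose extension contains the
        Lebesgue ball of \<open>x\<close>: a removed ball through \<open>x\<close> would bring a
        point of \<open>K\<close> outside \<open>U\<close> within \<open>\<epsilon>\<close> of
        \<open>x\<close>.\<close>
      obtain U where U: "U \<in> P" "mball x \<epsilon> \<subseteq> W U" using \<epsilon>(2)[OF x] by blast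
      then obtain i where i: "i < length Us" "Us ! i = U" using Us by (metis in_set_conv_nth)
      have "x \<notin> balls (set (J i))"
      proof
        assume "x \<in> balls (set (J i))"
        then obtain k where "k \<in> I i" "x \<in> bball k"
          using J[OF i(1)] by (auto simp: ball_union_def)
        then obtain j q y where *: "posrat_of_code q < \<epsilon> / 2" "y \<in> K" "y \<notin> U"
          "d (s j) y < posrat_of_code q" "d (s j) x < posrat_of_code q"
          by (auto simp: I_def i in_bball)
        have yM: "y \<in> M" and xM: "x \<in> M" using * x K_subset by auto
        have "d x y \<le> d x (s j) + d (s j) y" using triangle xM yM s_in by blast
        then have "y \<in> mball x \<epsilon>" using * xM yM by (simp add: commute)
        then show False using U W(2)[OF U(1)] * by blast
      qed
      with i show ?thesis by blast
    qed
    then show "K = (\<Union>i<length Us. K - balls (set (J i)))" by blast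
  qed
qed

text \<open>The complement of a member in \<open>K\<close> is the union of the others, so it is both
  compact and relatively open. Finitely many balls inside an open set \<open>W\<close> that traces
  this complement on \<open>K\<close> cover it, and they meet \<open>K\<close> nowhere else. No
  shrinking takes place, so disjointness survives.\<close>

lemma disjoint_cover_complement_balls:
  assumes Q: "is_open_cover KT Q" and disj: "disjoint Q"
  shows "\<exists>(n::nat) J. (\<forall>i<n. K - balls (set (J i)) \<in> Q) \<and>
    K = (\<Union>i<n. K - balls (set (J i))) \<and>
    (\<forall>i<n. \<forall>j<n. i \<noteq> j \<longrightarrow> (K - balls (set (J i))) \<inter> (K - balls (set (J j))) = {})"
proof -
  have fin: "finite Q" and op: "\<And>V. V \<in> Q \<Longrightarrow> openin KT V" and un: "\<Union>Q = K"
    using Q unfolding is_open_cover_def topspace_KT by auto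
  \<comment> \<open>Listing without repetition makes distinct indices name distinct, hence disjoint,
    members.\<close>
  obtain Vs where Vs: "set Vs = Q" "distinct Vs" using finite_distinct_list[OF fin] by blast
  have "\<exists>ks. K - balls (set ks) = V" if V: "V \<in> Q" for V
  proof -
    have "K - V = \<Union>(Q - {V})" using un disjointD[OF disj V] V by blast
    moreover have "openin KT (\<Union>(Q - {V}))" using op by (intro openin_Union) blast
    ultimately obtain W where W: "openin mtopology W" "K - V = W \<inter> K"
      by (auto simp: openin_subtopology)
    have "K - V \<subseteq> balls {k. bball k \<subseteq> W}"
    proof
      fix y assume "y \<in> K - V"
      then have "y \<in> W" using W(2) by blast
      then obtain k where "y \<in> bball k" "bball k \<subseteq> W" using ex_bball_in_open[OF W(1)] by blast
      then show "y \<in> balls {k. bball k \<subseteq> W}" by (auto simp: ball_union_def)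
    qed
    then obtain ks where ks: "set ks \<subseteq> {k. bball k \<subseteq> W}" "K - V \<subseteq> balls (set ks)"
      by (rule finite_ball_cover[OF compactin_complement_open[OF op[OF V]]])
    have "balls (set ks) \<subseteq> W" using ks(1) by (auto simp: ball_union_def)
    moreover have "V \<subseteq> K" using V un by blast
    ultimately have "K - balls (set ks) = V" using W(2) ks(2) by blast
    then show ?thesis ..
  qed
  then obtain f where f: "\<And>V. V \<in> Q \<Longrightarrow> K - balls (set (f V)) = V" by metis
  have J: "K - balls (set (f (Vs ! i))) = Vs ! i" if "i < length Vs" for i
    using f Vs(1) nth_mem[OF that] by blast
  show ?thesis
  proof (intro exI[of _ "length Vs"] exI[of _ "\<lambda>i. f (Vs ! i)"] conjI allI impI)
    show "K - balls (set (f (Vs ! i))) \<in> Q" if "i < length Vs" for i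
      using J[OF that] Vs(1) nth_mem[OF that] by simp
    have "(\<Union>i<length Vs. K - balls (set (f (Vs ! i)))) = (\<Union>i<length Vs. Vs ! i)"
      using J by auto
    also have "\<dots> = \<Union>(set Vs)" unfolding set_conv_nth by blast
    finally show "K = (\<Union>i<length Vs. K - balls (set (f (Vs ! i))))" using Vs(1) un by simp
    show "(K - balls (set (f (Vs ! i)))) \<inter> (K - balls (set (f (Vs ! j)))) = {}"
      if "i < length Vs" "j < length Vs" "i \<noteq> j" for i j
      unfolding J[OF that(1)] J[OF that(2)]
      using that Vs by (intro disjointD[OF disj]) (auto simp: nth_eq_iff_index_eq)
  qed
qed

text \<open>The action is computable on \<open>gs0\<close>, while words are spelled in
  \<open>gs\<close>. The two lists may differ, as a recursive presentation brings its own
  generators; \<open>eff_map_action\<close> passes from one to the other.\<close>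

lemma effective_codingI:
  assumes act: "topological_action G KT b"
    and eff: "generating_list G gs0" "\<forall>g\<in>set gs0. computable_map M d s K M d s (b g)"
    and gens: "generating_list G gs"
    and cover: "K = (\<Union>i<n. K - balls (set (J i)))"
    and sep: "\<And>z z'. z \<in> K \<Longrightarrow> z' \<in> K \<Longrightarrow> (\<And>g. g \<in> carrier G \<Longrightarrow>
        \<exists>i<n. b g z \<in> K - balls (set (J i)) \<and> b g z' \<in> K - balls (set (J i))) \<Longrightarrow> z = z'"
  shows "effective_coding M d s K G b n (\<lambda>i. K - balls (set (J i))) gs J"
proof -
  have action: "group_action G K b" and cont: "\<And>g. g \<in> carrier G \<Longrightarrow> continuous_map KT KT (b g)"
    using act unfolding topological_action_def topspace_KT by (auto simp: homeomorphic_imp_continuous_map)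
  interpret act: group_action G K b by (rule action)
  interpret group G using act.group_hom by (simp add: group_hom_def)
  have "eff_map (b g)" if g: "g \<in> set gs0" for g
  proof (rule eff_map_computable_map)
    have "g \<in> carrier G" using g eff(1) by (auto simp: generating_list_def)
    then show "b g \<in> K \<rightarrow> K" using act.action_closed by auto
  qed (use eff(2) g in blast)
  then have all_eff: "eff_map (b g)" if "g \<in> carrier G" for g
    using eff_map_action[OF action eff(1) cont _ that] by blast
  show ?thesis
  proof (intro effective_coding.intro effective_coding_axioms.intro closed_coding.intro
      closed_coding_axioms.intro rec_compact_set_axioms group_axioms)
    show "compact_space KT" by (simp add: compact_space_subtopology compactin_K)
    show "Hausdorff_space KT" by (simp add: Hausdorff_space_subtopology Hausdorff_space_mtopology)
    show "group_action G (topspace KT) b" unfolding topspace_KT by (rule action)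
    show "topspace KT = (\<Union>i<n. K - balls (set (J i)))" unfolding topspace_KT by (rule cover)
    show "z = z'" if "z \<in> topspace KT" "z' \<in> topspace KT"
      "\<And>g. g \<in> carrier G \<Longrightarrow> \<exists>i<n. b g z \<in> K - balls (set (J i)) \<and> b g z' \<in> K - balls (set (J i))" for z z'
      using sep that unfolding topspace_KT by blast
  qed (use closedin_complement_balls cont gens all_eff in auto)
qed

end

section \<open>Transfer from the model to the given system\<close>

theorem theorem4p12:
  fixes G :: "('g, 'b) monoid_scheme"
    and X :: "'x topology"
    and a :: "'g \<Rightarrow> 'x \<Rightarrow> 'x"
  assumes "effective_dynamical_system TYPE('m) G X a"
    and "\<exists>P. is_open_cover X P \<and> generating_cover G X a P"
  shows "(recursively_presented G \<longrightarrow>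
            (\<exists>A Y \<pi>. effective_subshift G A Y \<and>
               topological_factor_map G (subtopology (full_shift G A) Y) (shift G) X a \<pi>)) \<and>
         (zero_dimensional X \<longrightarrow>
            (\<exists>A Y \<pi>. effective_subshift G A Y \<and>
               topological_conjugacy G X a (subtopology (full_shift G A) Y) (shift G) \<pi>))"
proof -
  obtain M :: "'m set" and d s K b \<rho> where comp: "computable_action G M d s K b"
    and conj: "topological_conjugacy G X a (subtopology (Metric_space.mtopology M d) K) b \<rho>"
    and actX: "topological_action G X a"
    using assms(1) unfolding effective_dynamical_system_def by blast
  obtain P where P: "is_open_cover X P" "generating_cover G X a P" using assms(2) by blast
  have "computable_metric_space M d s" "recursively_compact M d s K"
    using comp by (auto simp: computable_action_def)
  then interpret rec_compact_set M d s K
    by (simp add: rec_compact_set_def rec_compact_set_axioms_def computable_metric_space_def)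
  have act: "topological_action G KT b" using comp by (simp add: computable_action_def)
  obtain gs0 where gs0: "generating_list G gs0" "\<forall>g\<in>set gs0. computable_map M d s K M d s (b g)"
    using comp by (auto simp: computable_action_def)
  have a_closed: "a g x \<in> topspace X" if "g \<in> carrier G" "x \<in> topspace X" for g x
    using actX that group_action.action_closed unfolding topological_action_def by metis
  have b_closed: "b g z \<in> K" if "g \<in> carrier G" "z \<in> K" for g z
    using act that group_action.action_closed unfolding topological_action_def topspace_KT by metis
  obtain \<rho>' where \<rho>': "topological_conjugacy G KT b X a \<rho>'"
    and inv: "\<And>x. x \<in> topspace X \<Longrightarrow> \<rho>' (\<rho> x) = x" "\<And>z. z \<in> topspace KT \<Longrightarrow> \<rho> (\<rho>' z) = z"
    using topological_conjugacy_inverse[OF conj a_closed] by blast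
  have \<rho>'_fac: "topological_factor_map G KT b X a \<rho>'" and \<rho>_hom: "homeomorphic_map X KT \<rho>"
    using \<rho>' conj by (auto simp: topological_conjugacy_def)
  have \<rho>'_eq: "\<rho>' (b g z) = a g (\<rho>' z)" "\<rho>' z \<in> topspace X" if "g \<in> carrier G" "z \<in> K" for g z
    using \<rho>'_fac that unfolding topological_factor_map_def topspace_KT by auto
  \<comment> \<open>Serves both the shrunken and the disjoint cover: a cover of \<open>K\<close>
    that refines the image of the generating cover inherits separation.\<close>
  have separates: "z = z'"
    if z: "z \<in> K" "z' \<in> K" and C: "\<And>i. i < n \<Longrightarrow> \<exists>U\<in>P. C i \<subseteq> \<rho> ` U"
      and same: "\<And>g. g \<in> carrier G \<Longrightarrow> \<exists>i<n. b g z \<in> C i \<and> b g z' \<in> C i"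
    for n :: nat and C z z'
  proof -
    have one: "\<one>\<^bsub>G\<^esub> \<in> carrier G"
      using act by (simp add: topological_action_def group_action_def group_hom_def group.is_monoid monoid.one_closed)
    have "\<rho>' z = \<rho>' z'"
    proof (rule generating_cover_separates[OF P(2)])
      fix g assume g: "g \<in> carrier G"
      then obtain U where U: "U \<in> P" "b g z \<in> \<rho> ` U" "b g z' \<in> \<rho> ` U"
        using same C by (metis subsetD)
      have "U \<subseteq> topspace X" using P(1) U(1) by (auto simp: is_open_cover_def)
      then have "\<rho>' (b g z) \<in> U" "\<rho>' (b g z') \<in> U" using U inv(1) by auto
      then show "\<exists>U\<in>P. a g (\<rho>' z) \<in> U \<and> a g (\<rho>' z') \<in> U"
        using U(1) \<rho>'_eq(1) g z by auto
    qed (use \<rho>'_eq(2) z one in blast)+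
    then show ?thesis using inv(2) z unfolding topspace_KT by metis
  qed
  show ?thesis
  proof (intro conjI impI)
    assume "recursively_presented G"
    then obtain gs where gs: "generating_list G gs" "\<forall>g\<in>set gs. inv\<^bsub>G\<^esub> g \<in> set gs"
      "re_set {list_encode w | w. set w \<subseteq> {..<length gs} \<and> monoid_word_value G gs w = \<one>\<^bsub>G\<^esub>}"
      unfolding recursively_presented_def by blast
    obtain n :: nat and J where J: "\<And>i. i < n \<Longrightarrow> \<exists>V\<in>(`) \<rho> ` P. K - balls (set (J i)) \<subseteq> V"
      "K = (\<Union>i<n. K - balls (set (J i)))"
      using closed_shrinking[OF is_open_cover_homeomorphic_image[OF P(1) \<rho>_hom]] by auto
    interpret effective_coding M d s K G b n "\<lambda>i. K - balls (set (J i))" gs J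
    proof (rule effective_codingI[OF act gs0 gs(1) J(2)])
      show "z = z'" if "z \<in> K" "z' \<in> K" "\<And>g. g \<in> carrier G \<Longrightarrow>
        \<exists>i<n. b g z \<in> K - balls (set (J i)) \<and> b g z' \<in> K - balls (set (J i))" for z z'
        using separates[OF that(1,2) _ that(3)] J(1) by blast
    qed
    show "\<exists>A Y \<pi>. effective_subshift G A Y \<and>
        topological_factor_map G (subtopology (full_shift G A) Y) (shift G) X a \<pi>"
      using effective_coding_shift_recursively_presented[OF gs(2,3)]
        topological_factor_map_compose[OF factor_map_coded_point \<rho>'_fac] by blast
  next
    assume "zero_dimensional X"
    then obtain Q where Q: "is_open_cover X Q" "\<And>V. V \<in> Q \<Longrightarrow> \<exists>U\<in>P. V \<subseteq> U" "disjoint Q"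
      using zero_dimensional_disjoint_refinement[OF _ P(1)] by blast
    have disj: "disjoint ((`) \<rho> ` Q)"
      using Q(1,3) homeomorphic_imp_injective_map[OF \<rho>_hom]
      by (intro disjoint_image) (simp_all add: is_open_cover_def)
    obtain n :: nat and J where nJ: "\<forall>i<n. K - balls (set (J i)) \<in> (`) \<rho> ` Q"
      "K = (\<Union>i<n. K - balls (set (J i)))"
      "\<forall>i<n. \<forall>j<n. i \<noteq> j \<longrightarrow> (K - balls (set (J i))) \<inter> (K - balls (set (J j))) = {}"
      using disjoint_cover_complement_balls[OF is_open_cover_homeomorphic_image[OF Q(1) \<rho>_hom] disj]
      by (elim exE conjE) (rule that)
    note J = nJ(1)[rule_format] nJ(2) nJ(3)[rule_format]
    \<comment> \<open>Words are spelled in \<open>gs0\<close> itself; inverses are letters of their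
      own, so this list may fail to be symmetric.\<close>
    interpret effective_coding M d s K G b n "\<lambda>i. K - balls (set (J i))" gs0 J
    proof (rule effective_codingI[OF act gs0 gs0(1) J(2)])
      have refine: "\<exists>U\<in>P. K - balls (set (J i)) \<subseteq> \<rho> ` U" if "i < n" for i
      proof -
        from J(1)[OF that] obtain V where V: "V \<in> Q" "K - balls (set (J i)) = \<rho> ` V" by (rule imageE)
        obtain U where "U \<in> P" "V \<subseteq> U" using Q(2)[OF V(1)] by (rule bexE)
        then show ?thesis unfolding V(2) by (intro bexI[of _ U] image_mono)
      qed
      show "z = z'" if "z \<in> K" "z' \<in> K" "\<And>g. g \<in> carrier G \<Longrightarrow>
        \<exists>i<n. b g z \<in> K - balls (set (J i)) \<and> b g z' \<in> K - balls (set (J i))" for z z'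
        by (rule separates[OF that(1,2) refine that(3)])
    qed
    obtain \<pi> where "topological_conjugacy G KT b (subtopology (full_shift G {..<n}) coding_shift) (shift G) \<pi>"
      using conjugacy_coding_shift[OF J(3)] by blast
    then show "\<exists>A Y \<pi>. effective_subshift G A Y \<and>
        topological_conjugacy G X a (subtopology (full_shift G A) Y) (shift G) \<pi>"
      using effective_coding_shift_disjoint[OF J(3)] topological_conjugacy_compose[OF conj] by blast
  qed
qed

end
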